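(* Let $\Gamma$ be a countable discrete infinite group, let $\pi:\beta\Gamma\to\Gamma^{WAP}$ be the canonical map, and let $X=\beta\Gamma\setminus\Gamma$, $Y=\Gamma^{WAP}\setminus\Gamma$, $Y^2=\{yz:y,z\in Y\}$, $Z=Z_R\cup Z_L$ as in the context. Then: (1) $\pi^{-1}(\mathrm{cls}\,Y^2)=Z=Z_R\cup Z_L$, hence $\pi^{-1}(Y\setminus\mathrm{cls}\,Y^2)=X\setminus Z$, where $\mathrm{cls}\,Y^2$ is the closure of $Y^2$ in $\Gamma^{WAP}$. (2) $X\setminus Z$ is an open dense subset of $X$, and the restriction of $\pi$ to $X\setminus Z$ is a homeomorphism from $X\setminus Z$ onto $Y\setminus\mathrm{cls}\,Y^2$.
   Context: $\Gamma$ is a countable discrete infinite group. $\beta\Gamma$ is its Čech–Stone compactification, viewed as the space of ultrafilters on $\Gamma$, with $\gamma\in\Gamma$ identified with the principal ultrafilter at $\gamma$. For $A\subset\Gamma$ and $\alpha\in\Gamma$ put $\alpha^{-1}A=\{\alpha^{-1}a:a\in A\}$ and $A\alpha^{-1}=\{a\alpha^{-1}:a\in A\}$. Two products on $\beta\Gamma$ extending that of $\Gamma$ are defined, for $p,q\in\beta\Gamma$, by $$pq=\{A\subset\Gamma:\{\alpha\in\Gamma:\alpha^{-1}A\in q\}\in p\},\qquad p\cdot q=\{A\subset\Gamma:\{\alpha\in\Gamma:A\alpha^{-1}\in p\}\in q\}.$$ With $X=\beta\Gamma\setminus\Gamma$, let $Z_R$ be the closure in $\beta\Gamma$ of $\{pq:p,q\in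 X\}$, let $Z_L$ be the closure in $\beta\Gamma$ of $\{p\cdot q:p,q\in X\}$, and let $Z=Z_R\cup Z_L$ (a subset of $X$). A function $f\in\ell_\infty(\Gamma)$ (bounded complex-valued) is weakly almost periodic if its orbit under translations by elements of $\Gamma$ is weakly precompact in the Banach space $\ell_\infty(\Gamma)$; $WAP(\Gamma)$ is the $C^*$-algebra of such functions and $\Gamma^{WAP}$ is its Gelfand (maximal ideal) space. $\Gamma^{WAP}$ is the universal semitopological semigroup compactification of $\Gamma$: it is a compact semigroup whose multiplication extends that of $\Gamma$ and is separately continuous. $\Gamma$ is regarded as a dense discrete subset of both $\beta\Gamma$ and $\Gamma^{WAP}$. The canonical map $\pi:\beta\Gamma\to\Gamma^{WAP}$ is the unique continuous map with $\pi(\gamma)=\gamma$ for all $\gamma\in\Gamma$ (it is surjective and a homomorphism for both products on $\beta\Gamma$). *)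

theory Defs
  imports "HOL-Analysis.Analysis"
begin

text \<open>
  Groups are types of class \<open>group_add\<close>: the group operation is written additively but is
  \<^emph>\<open>not\<close> assumed to be commutative, so \<open>\<alpha> + x\<close> is the product \<open>\<alpha>x\<close>, and \<open>- \<alpha>\<close> is the inverse
  of \<open>\<alpha>\<close>.
\<close>

section \<open>The Cech--Stone compactification of a discrete group\<close>

definition ultrafilters :: "'a set set set" where
  "ultrafilters =
    {p. UNIV \<in> p \<and> {} \<notin> p \<and>
        (\<forall>A B. A \<in> p \<longrightarrow> B \<in> p \<longrightarrow> A \<inter> B \<in> p) \<and>
        (\<forall>A B. A \<in> p \<longrightarrow> A \<subseteq> B \<longrightarrow> B \<in> p) \<and>
        (\<forall>A. A \<in> p \<or> - A \<in> p)}"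

definition beta_topology :: "'a set set topology" where
  "beta_topology = topology_generated_by {{p \<in> ultrafilters. A \<in> p} | A. True}"

definition principal :: "'a \<Rightarrow> 'a set set" where
  "principal x = {A. x \<in> A}"

definition beta_remainder :: "'a set set set" where
  "beta_remainder = ultrafilters - range principal"

text \<open>The products \<open>pq\<close> and \<open>p \<cdot> q\<close> respectively.\<close>

definition ultra_mult_R :: "'a::group_add set set \<Rightarrow> 'a set set \<Rightarrow> 'a set set" where
  "ultra_mult_R p q = {A. {\<alpha>. (\<lambda>a. - \<alpha> + a) ` A \<in> q} \<in> p}"

definition ultra_mult_L :: "'a::group_add set set \<Rightarrow> 'a set set \<Rightarrow> 'a set set" where
  "ultra_mult_L p q = {A. {\<alpha>. (\<lambda>a. a + - \<alpha>) ` A \<in> p} \<in> q}"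

definition Z_R :: "'a::group_add set set set" where
  "Z_R = beta_topology closure_of
     {ultra_mult_R p q | p q. p \<in> beta_remainder \<and> q \<in> beta_remainder}"

definition Z_L :: "'a::group_add set set set" where
  "Z_L = beta_topology closure_of
     {ultra_mult_L p q | p q. p \<in> beta_remainder \<and> q \<in> beta_remainder}"


section \<open>Weakly almost periodic functions\<close>

definition linfty :: "('a \<Rightarrow> complex) set" where
  "linfty = {f. bounded (range f)}"

definition linfty_norm :: "('a \<Rightarrow> complex) \<Rightarrow> real" where
  "linfty_norm f = (SUP x. norm (f x))"

text \<open>Only the values of a functional on \<^const>\<open>linfty\<close> are relevant.\<close>

definition linfty_dual :: "(('a \<Rightarrow> complex) \<Rightarrow> complex) set" where
  "linfty_dual =
    {\<Phi>. (\<forall>f\<in>linfty. \<forall>g\<in>linfty. \<Phi> (\<lambda>x. f x + g x) = \<Phi> f + \<Phi> g) \<and>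
        (\<forall>c. \<forall>f\<in>linfty. \<Phi> (\<lambda>x. c * f x) = c * \<Phi> f) \<and>
        (\<exists>C. \<forall>f\<in>linfty. norm (\<Phi> f) \<le> C * linfty_norm f)}"

definition linfty_weak_topology :: "('a \<Rightarrow> complex) topology" where
  "linfty_weak_topology =
    topology_generated_by {{f \<in> linfty. \<Phi> f \<in> U} | \<Phi> U. \<Phi> \<in> linfty_dual \<and> open U}"

text \<open>
  Left translates are used here; the functions with relatively weakly compact right orbit
  are the same ones, by Grothendieck's double limit criterion.
\<close>

definition orbit :: "('a::group_add \<Rightarrow> complex) \<Rightarrow> ('a \<Rightarrow> complex) set" where
  "orbit f = {(\<lambda>x. f (\<gamma> + x)) | \<gamma>. True}"

definition WAP :: "('a::group_add \<Rightarrow> complex) set" where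
  "WAP = {f \<in> linfty. compactin linfty_weak_topology (linfty_weak_topology closure_of orbit f)}"


section \<open>The WAP compactification\<close>

text \<open>
  The Gelfand space: nonzero multiplicative linear functionals on \<^const>\<open>WAP\<close>, extended
  by \<^const>\<open>undefined\<close> outside \<^const>\<open>WAP\<close> so that they are determined by their values there.
\<close>

definition wap_space :: "(('a::group_add \<Rightarrow> complex) \<Rightarrow> complex) set" where
  "wap_space =
    {\<phi> \<in> extensional WAP.
        (\<forall>f\<in>WAP. \<forall>g\<in>WAP. \<phi> (\<lambda>x. f x + g x) = \<phi> f + \<phi> g) \<and>
        (\<forall>c. \<forall>f\<in>WAP. \<phi> (\<lambda>x. c * f x) = c * \<phi> f) \<and>
        (\<forall>f\<in>WAP. \<forall>g\<in>WAP. \<phi> (\<lambda>x. f x * g x) = \<phi> f * \<phi> g) \<and>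
        (\<exists>f\<in>WAP. \<phi> f \<noteq> 0)}"

definition wap_topology :: "(('a::group_add \<Rightarrow> complex) \<Rightarrow> complex) topology" where
  "wap_topology =
    topology_generated_by {{\<phi> \<in> wap_space. \<phi> f \<in> U} | f U. f \<in> WAP \<and> open U}"

definition wap_point :: "'a::group_add \<Rightarrow> (('a \<Rightarrow> complex) \<Rightarrow> complex)" where
  "wap_point x = restrict (\<lambda>f. f x) WAP"

definition wap_remainder :: "(('a::group_add \<Rightarrow> complex) \<Rightarrow> complex) set" where
  "wap_remainder = wap_space - range wap_point"

text \<open>
  The multiplication of the compactification is the unique separately continuous semigroup
  operation extending that of the group. Like the canonical map below, it is made
  \<^const>\<open>extensional\<close> so that it is unique as a HOL function.
\<close>

definition wap_mult ::
    "(('a::group_add \<Rightarrow> complex) \<Rightarrow> complex) \<times> (('a \<Rightarrow> complex) \<Rightarrow> complex)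
      \<Rightarrow> (('a \<Rightarrow> complex) \<Rightarrow> complex)" where
  "wap_mult = (THE m.
     m \<in> (wap_space \<times> wap_space) \<rightarrow>\<^sub>E wap_space \<and>
     (\<forall>x\<in>wap_space. \<forall>y\<in>wap_space. \<forall>z\<in>wap_space. m (m (x, y), z) = m (x, m (y, z))) \<and>
     (\<forall>\<gamma> \<delta>. m (wap_point \<gamma>, wap_point \<delta>) = wap_point (\<gamma> + \<delta>)) \<and>
     (\<forall>x\<in>wap_space. continuous_map wap_topology wap_topology (\<lambda>y. m (x, y))) \<and>
     (\<forall>y\<in>wap_space. continuous_map wap_topology wap_topology (\<lambda>x. m (x, y))))"

definition wap_remainder_sq :: "(('a::group_add \<Rightarrow> complex) \<Rightarrow> complex) set" where
  "wap_remainder_sq = {wap_mult (y, z) | y z. y \<in> wap_remainder \<and> z \<in> wap_remainder}"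

definition canonical_map :: "'a::group_add set set \<Rightarrow> (('a \<Rightarrow> complex) \<Rightarrow> complex)" where
  "canonical_map = (THE \<pi>.
     \<pi> \<in> extensional ultrafilters \<and>
     continuous_map beta_topology wap_topology \<pi> \<and>
     (\<forall>\<gamma>. \<pi> (principal \<gamma>) = wap_point \<gamma>))"

end

theory Submission
  imports Defs
begin

text \<open>
  By Grothendieck's double limit criterion, a bounded function is weakly almost periodic iff its
  extension to ultrafilters takes the same value at \<open>pq\<close> and at \<open>p \<cdot> q\<close> for all \<open>p\<close> and \<open>q\<close>.
  Hence every bounded function supported on a set \<open>A\<close> that belongs to no element of \<open>Z\<close> is weakly
  almost periodic, so the compactification is not collapsed off \<open>Z\<close>, and the indicator
  function of \<open>A\<close> separates the image of the corresponding neighbourhood from all products of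
  remainder points. Density holds because every infinite set contains an infinite subset whose
  translates have pairwise finite intersections, which therefore belongs to no element of \<open>Z\<close>.
\<close>

section \<open>Ultrafilters and limits along them\<close>

text \<open>The hard half of the criterion is that equal iterated limits force weak compactness. The
  natural candidate for the orbit closure is the set of functions \<open>h p\<close>, where
  \<open>h p y\<close> is the limit of \<open>f (x + y)\<close> along \<open>p\<close>. It is weakly
  compact as soon as \<open>h\<close> is weakly continuous, that is, as soon as every bounded
  functional commutes with the limit along \<open>p\<close>. The criterion is symmetric in the two
  factors although \<open>WAP\<close> speaks of left translates alone. This symmetry gives
  invariance under right translations too, so that the product passes to the quotient, with
  continuity in one variable coming from \<open>pq\<close> and in the other from
  \<open>p \<cdot> q\<close>. The homeomorphism needs no explicit inverse: a continuous map from a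
  compact space to a Hausdorff space is closed, and it stays closed on the full preimage of a
  set.\<close>

lemma ultrafilters_UNIV: "p \<in> ultrafilters \<Longrightarrow> UNIV \<in> p"
  and ultrafilters_empty: "p \<in> ultrafilters \<Longrightarrow> {} \<notin> p"
  and ultrafilters_Int: "p \<in> ultrafilters \<Longrightarrow> A \<in> p \<Longrightarrow> B \<in> p \<Longrightarrow> A \<inter> B \<in> p"
  and ultrafilters_mono: "p \<in> ultrafilters \<Longrightarrow> A \<in> p \<Longrightarrow> A \<subseteq> B \<Longrightarrow> B \<in> p"
  and ultrafilters_dichotomy: "p \<in> ultrafilters \<Longrightarrow> A \<in> p \<or> - A \<in> p"
  unfolding ultrafilters_def by blast+

lemma ultrafilters_Compl_iff: "p \<in> ultrafilters \<Longrightarrow> - A \<in> p \<longleftrightarrow> A \<notin> p"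
  by (metis Compl_disjoint ultrafilters_Int ultrafilters_dichotomy ultrafilters_empty)

lemma ultrafilters_Int_iff: "p \<in> ultrafilters \<Longrightarrow> A \<inter> B \<in> p \<longleftrightarrow> A \<in> p \<and> B \<in> p"
  by (meson inf_le1 inf_le2 ultrafilters_Int ultrafilters_mono)

lemma ultrafilters_Un_iff: "p \<in> ultrafilters \<Longrightarrow> A \<union> B \<in> p \<longleftrightarrow> A \<in> p \<or> B \<in> p"
  by (metis Compl_Un ultrafilters_Compl_iff ultrafilters_Int_iff)

lemma ultrafilters_UN_finite:
  assumes p: "p \<in> ultrafilters" and "finite I" "(\<Union>i\<in>I. A i) \<in> p"
  shows "\<exists>i\<in>I. A i \<in> p"
  using assms(2,3)
  by (induction I) (auto simp: ultrafilters_empty[OF p] ultrafilters_Un_iff[OF p])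

lemma ultrafilters_eqI:
  assumes "p \<in> ultrafilters" "q \<in> ultrafilters" "p \<subseteq> q"
  shows "p = q"
  using assms ultrafilters_Compl_iff by blast

lemma principal_ultrafilter: "principal x \<in> ultrafilters"
  by (auto simp: principal_def ultrafilters_def)

lemma ultrafilter_singleton:
  assumes p: "p \<in> ultrafilters" and "{x} \<in> p"
  shows "p = principal x"
proof (rule ultrafilters_eqI[symmetric, OF principal_ultrafilter p], rule)
  fix A assume "A \<in> principal x"
  then show "A \<in> p"
    using ultrafilters_mono[OF p assms(2)] by (simp add: principal_def)
qed

lemma beta_remainder_ultrafilter: "p \<in> beta_remainder \<Longrightarrow> p \<in> ultrafilters"
  by (simp add: beta_remainder_def)

lemma beta_remainder_iff:
  "p \<in> beta_remainder \<longleftrightarrow> p \<in> ultrafilters \<and> (\<forall>x. {x} \<notin> p)"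
proof -
  have "p = principal x \<longleftrightarrow> {x} \<in> p" if "p \<in> ultrafilters" for x
    using ultrafilter_singleton[OF that, of x] by (auto simp: principal_def)
  then show ?thesis by (auto simp: beta_remainder_def)
qed

lemma beta_remainder_finite:
  assumes "p \<in> beta_remainder" "finite A"
  shows "A \<notin> p"
  using assms ultrafilters_UN_finite[of p A "\<lambda>x. {x}"] by (auto simp: beta_remainder_iff)

text \<open>Zorn gives a maximal family with the finite intersection property. A set outside it must
  miss some finite intersection of members, and this one fact yields closure under intersections and
  supersets as well as the dichotomy.\<close>

lemma ultrafilter_extends_FIP:
  assumes fip: "\<And>\<F>. finite \<F> \<Longrightarrow> \<F> \<subseteq> \<B> \<Longrightarrow> \<Inter>\<F> \<noteq> {}"
  shows "\<exists>p\<in>ultrafilters. \<B> \<subseteq> p"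
proof -
  define \<A> where "\<A> = {\<C>. \<B> \<subseteq> \<C> \<and> (\<forall>\<F>. finite \<F> \<longrightarrow> \<F> \<subseteq> \<C> \<longrightarrow> \<Inter>\<F> \<noteq> {})}"
  have "\<exists>M\<in>\<A>. \<forall>X\<in>\<A>. M \<subseteq> X \<longrightarrow> X = M"
  proof (rule subset_Zorn_nonempty)
    show "\<A> \<noteq> {}" using fip unfolding \<A>_def by blast
  next
    fix \<C> assume ne: "\<C> \<noteq> {}" and ch: "subset.chain \<A> \<C>"
    have "\<Inter>\<F> \<noteq> {}" if F: "finite \<F>" "\<F> \<subseteq> \<Union>\<C>" for \<F>
    proof -
      obtain c where "c \<in> \<C>" "\<F> \<subseteq> c"
        using finite_subset_Union_chain[OF F ne ch] by blast
      then show ?thesis using ch F(1) by (auto simp: subset.chain_def \<A>_def)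
    qed
    moreover have "\<B> \<subseteq> \<Union>\<C>" using ne ch unfolding subset.chain_def \<A>_def by blast
    ultimately show "\<Union>\<C> \<in> \<A>" unfolding \<A>_def by blast
  qed
  then obtain M where MA: "M \<in> \<A>" and max_A: "\<And>X. X \<in> \<A> \<Longrightarrow> M \<subseteq> X \<Longrightarrow> X = M"
    by metis
  have M: "\<B> \<subseteq> M" "\<And>\<F>. finite \<F> \<Longrightarrow> \<F> \<subseteq> M \<Longrightarrow> \<Inter>\<F> \<noteq> {}" using MA by (simp_all add: \<A>_def)
  have max: "X = M"
    if "\<B> \<subseteq> X" "\<And>\<F>. finite \<F> \<Longrightarrow> \<F> \<subseteq> X \<Longrightarrow> \<Inter>\<F> \<noteq> {}" "M \<subseteq> X" for X
    using max_A[of X] that by (simp add: \<A>_def)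
  have witness: "\<exists>\<F>. finite \<F> \<and> \<F> \<subseteq> M \<and> \<Inter>\<F> \<inter> A = {}" if "A \<notin> M" for A
  proof (rule ccontr)
    assume neg: "\<not> ?thesis"
    have "insert A M = M"
    proof (rule max)
      fix \<F> assume F: "finite \<F>" "\<F> \<subseteq> insert A M"
      have "finite (\<F> - {A})" "\<F> - {A} \<subseteq> M" using F by auto
      then have "\<Inter>(\<F> - {A}) \<inter> A \<noteq> {}" using neg by simp
      moreover have "\<Inter>(\<F> - {A}) \<inter> A \<subseteq> \<Inter>\<F>" by auto
      ultimately show "\<Inter>\<F> \<noteq> {}" by auto
    qed (use M in auto)
    then show False using that by blast
  qed
  have mem: "A \<in> M" if "finite \<G>" "\<G> \<subseteq> M" "\<Inter>\<G> \<subseteq> A" for A \<G>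
  proof (rule ccontr)
    assume "A \<notin> M"
    from witness[OF this] obtain \<F> where F: "finite \<F>" "\<F> \<subseteq> M" "\<Inter>\<F> \<inter> A = {}"
      by (elim exE conjE)
    have "\<Inter>(\<F> \<union> \<G>) \<noteq> {}" using F that by (intro M(2)) simp_all
    then show False using that(3) F(3) by (auto simp: Inter_Un_distrib)
  qed
  have dich: "A \<in> M \<or> - A \<in> M" for A
  proof (rule ccontr)
    assume "\<not> ?thesis"
    then have nmem: "A \<notin> M" "- A \<notin> M" by simp_all
    from witness[OF nmem(1)] obtain \<F> where F: "finite \<F>" "\<F> \<subseteq> M" "\<Inter>\<F> \<inter> A = {}"
      by (elim exE conjE)
    from witness[OF nmem(2)] obtain \<G> where G: "finite \<G>" "\<G> \<subseteq> M" "\<Inter>\<G> \<inter> - A = {}"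
      by (elim exE conjE)
    have "\<Inter>(\<F> \<union> \<G>) \<noteq> {}" using F G by (intro M(2)) simp_all
    then show False using F(3) G(3) by (auto simp: Inter_Un_distrib)
  qed
  have "M \<in> ultrafilters"
    unfolding ultrafilters_def
  proof (intro CollectI conjI allI impI)
    show "UNIV \<in> M" using mem[of "{}"] by simp
    show "{} \<notin> M" using M(2)[of "{{}}"] by auto
    show "A \<inter> B \<in> M" if "A \<in> M" "B \<in> M" for A B using mem[of "{A, B}"] that by simp
    show "B \<in> M" if "A \<in> M" "A \<subseteq> B" for A B using mem[of "{A}"] that by simp
  qed (use dich in blast)
  with M(1) show ?thesis by auto
qed

lemma ultrafilter_extends_directed:
  assumes ne: "\<B> \<noteq> {}" and empty: "{} \<notin> \<B>"
    and dir: "\<And>A B. A \<in> \<B> \<Longrightarrow> B \<in> \<B> \<Longrightarrow> \<exists>C\<in>\<B>. C \<subseteq> A \<inter> B"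
  shows "\<exists>p\<in>ultrafilters. \<B> \<subseteq> p"
proof (rule ultrafilter_extends_FIP)
  fix \<F> :: "'a set set" assume "finite \<F>" "\<F> \<subseteq> \<B>"
  then have "\<exists>C\<in>\<B>. C \<subseteq> \<Inter>\<F>"
  proof (induction \<F>)
    case empty
    then show ?case using ne by auto
  next
    case (insert A \<F>)
    then obtain C where "C \<in> \<B>" "C \<subseteq> \<Inter>\<F>" by auto
    then show ?case using dir[of A C] insert.prems by (metis Inter_insert insert_subset order_trans inf_mono order_refl)
  qed
  then show "\<Inter>\<F> \<noteq> {}" using empty by auto
qed

text \<open>An ultrafilter that contains \<open>A - F\<close> for all finite \<open>F\<close> cannot
  contain \<open>{x}\<close>, since \<open>{x}\<close> and \<open>A - {x}\<close> are
  disjoint.\<close>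

lemma free_ultrafilter_exists:
  assumes "infinite A"
  shows "\<exists>p\<in>beta_remainder. A \<in> p"
proof -
  have "\<exists>p\<in>ultrafilters. {A - F | F. finite F} \<subseteq> p"
  proof (rule ultrafilter_extends_directed)
    show "{} \<notin> {A - F | F. finite F}" using assms by (auto simp: Diff_eq_empty_iff dest: finite_subset)
    fix B C assume "B \<in> {A - F | F. finite F}" "C \<in> {A - F | F. finite F}"
    then obtain F G where "B = A - F" "C = A - G" "finite F" "finite G" by auto
    then have "A - (F \<union> G) \<in> {A - F | F. finite F}" "A - (F \<union> G) \<subseteq> B \<inter> C" by auto
    then show "\<exists>D\<in>{A - F | F. finite F}. D \<subseteq> B \<inter> C" by blast
  qed auto
  then obtain p where p: "p \<in> ultrafilters" and sub: "\<And>F. finite F \<Longrightarrow> A - F \<in> p" by blast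
  have "{x} \<notin> p" for x
    using sub[of "{x}"] ultrafilters_Int[OF p, of "{x}" "A - {x}"] ultrafilters_empty[OF p] by auto
  then show ?thesis using p sub[of "{}"] by (auto simp: beta_remainder_iff)
qed

text \<open>The same ultrafilter as an object of type \<open>filter\<close>, so that
  \<open>eventually\<close> and \<open>tendsto\<close> apply. \<open>Abs_filter\<close> is
  meaningful only if \<open>p\<close> is a filter, which is why later lemmas assume
  \<open>p \<in> ultrafilters\<close>.\<close>

definition ufilter :: "'a set set \<Rightarrow> 'a filter" where
  "ufilter p = Abs_filter (\<lambda>P. {x. P x} \<in> p)"

lemma eventually_ufilter:
  assumes p: "p \<in> ultrafilters"
  shows "eventually P (ufilter p) \<longleftrightarrow> {x. P x} \<in> p"
  unfolding ufilter_def
proof (rule eventually_Abs_filter, rule is_filter.intro)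
  show "{x. True} \<in> p" using ultrafilters_UNIV[OF p] by simp
  show "{x. P x \<and> Q x} \<in> p" if "{x. P x} \<in> p" "{x. Q x} \<in> p" for P Q
    using ultrafilters_Int[OF p that] by (simp add: Collect_conj_eq)
  show "{x. Q x} \<in> p" if "\<forall>x. P x \<longrightarrow> Q x" "{x. P x} \<in> p" for P Q
    using ultrafilters_mono[OF p that(2)] that(1) by blast
qed

lemma ufilter_nonbot: "p \<in> ultrafilters \<Longrightarrow> ufilter p \<noteq> bot"
  by (simp add: trivial_limit_def eventually_ufilter ultrafilters_empty)

text \<open>The value at \<open>p\<close> of the continuous extension of \<open>f\<close> to the
  space of ultrafilters. The limit is known to exist for \<open>f \<in> linfty\<close>.\<close>

definition ulim :: "'a set set \<Rightarrow> ('a \<Rightarrow> complex) \<Rightarrow> complex" where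
  "ulim p f = Lim (ufilter p) f"

lemma ulim_eqI: "p \<in> ultrafilters \<Longrightarrow> (f \<longlongrightarrow> l) (ufilter p) \<Longrightarrow> ulim p f = l"
  unfolding ulim_def using tendsto_Lim ufilter_nonbot by blast

text \<open>Compactness provides a cluster point only; for an ultrafilter it is a limit, because
  otherwise the complement of the preimage of a neighbourhood would belong to
  \<open>p\<close>.\<close>

lemma ultrafilter_compact_limit:
  fixes f :: "'a \<Rightarrow> 'b::t2_space"
  assumes p: "p \<in> ultrafilters" and K: "compact K" and f: "range f \<subseteq> K"
  shows "\<exists>l. (f \<longlongrightarrow> l) (ufilter p)"
proof -
  have "filtermap f (ufilter p) \<noteq> bot" using ufilter_nonbot[OF p] by (simp add: filtermap_bot_iff)
  moreover have "eventually (\<lambda>x. x \<in> K) (filtermap f (ufilter p))"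
    using f by (simp add: eventually_filtermap range_subsetD)
  ultimately obtain l where l: "inf (nhds l) (filtermap f (ufilter p)) \<noteq> bot"
    using K unfolding compact_filter by blast
  have "(f \<longlongrightarrow> l) (ufilter p)"
  proof (rule topological_tendstoI)
    fix S assume S: "open S" "l \<in> S"
    show "eventually (\<lambda>x. f x \<in> S) (ufilter p)"
    proof (rule ccontr)
      assume "\<not> ?thesis"
      then have "eventually (\<lambda>x. x \<notin> S) (filtermap f (ufilter p))"
        using ultrafilters_Compl_iff[OF p, of "{x. f x \<in> S}"]
        by (simp add: eventually_filtermap eventually_ufilter[OF p] Collect_neg_eq)
      moreover have "eventually (\<lambda>x. x \<in> S) (nhds l)" using S eventually_nhds by blast
      ultimately have "eventually (\<lambda>x. False) (inf (nhds l) (filtermap f (ufilter p)))"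
        unfolding eventually_inf by blast
      then show False using l by (simp add: trivial_limit_def)
    qed
  qed
  then show ?thesis by blast
qed

lemma tendsto_ulim:
  assumes p: "p \<in> ultrafilters" and f: "f \<in> linfty"
  shows "(f \<longlongrightarrow> ulim p f) (ufilter p)"
proof -
  have "compact (closure (range f))" using f by (simp add: linfty_def)
  from ultrafilter_compact_limit[OF p this closure_subset]
  obtain l where "(f \<longlongrightarrow> l) (ufilter p)" by (elim exE)
  then show ?thesis using ulim_eqI[OF p] by simp
qed

section \<open>Bounded functions and the algebra of limits along an ultrafilter\<close>

lemma linfty_iff: "f \<in> linfty \<longleftrightarrow> (\<exists>M. \<forall>x. norm (f x) \<le> M)"
  by (auto simp: linfty_def bounded_iff)

lemma linfty_comp: "f \<in> linfty \<Longrightarrow> (\<lambda>x. f (g x)) \<in> linfty"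
  by (auto simp: linfty_iff)

lemma linfty_const: "(\<lambda>x. c) \<in> linfty"
  by (auto simp: linfty_iff)

lemma linfty_add: "f \<in> linfty \<Longrightarrow> g \<in> linfty \<Longrightarrow> (\<lambda>x. f x + g x) \<in> linfty"
  using bounded_plus_comp[of f UNIV g] by (simp add: linfty_def)

lemma linfty_mult: "f \<in> linfty \<Longrightarrow> g \<in> linfty \<Longrightarrow> (\<lambda>x. f x * g x) \<in> linfty"
  unfolding linfty_iff
proof (elim exE)
  fix M N assume M: "\<forall>x. norm (f x) \<le> M" and N: "\<forall>x. norm (g x) \<le> N"
  have "norm (f x * g x) \<le> M * N" for x
    unfolding norm_mult by (rule mult_mono') (use M N in auto)
  then show "\<exists>M. \<forall>x. norm (f x * g x) \<le> M" by blast
qed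

lemma linfty_diff: "f \<in> linfty \<Longrightarrow> g \<in> linfty \<Longrightarrow> (\<lambda>x. f x - g x) \<in> linfty"
  using bounded_minus_comp[of f UNIV g] by (simp add: linfty_def)

lemma linfty_indicator: "(indicator A :: 'a \<Rightarrow> complex) \<in> linfty"
  unfolding linfty_iff by (rule exI[of _ 1]) (simp add: indicator_def)

text \<open>The centre \<open>c\<close> is left free: with \<open>c = 0\<close> this bounds limits,
  with \<open>c\<close> another limit it compares the two.\<close>

lemma ulim_norm_le:
  assumes p: "p \<in> ultrafilters" and f: "f \<in> linfty" and "eventually (\<lambda>x. norm (f x - c) \<le> M) (ufilter p)"
  shows "norm (ulim p f - c) \<le> M"
  by (rule tendsto_upperbound[OF tendsto_norm[OF tendsto_diff[OF tendsto_ulim[OF p f] tendsto_const]]])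
     (use assms ufilter_nonbot[OF p] in auto)

lemma linfty_ulim:
  assumes q: "q \<in> ultrafilters" and bd: "\<And>x y. norm (F x y) \<le> M"
  shows "(\<lambda>x. ulim q (F x)) \<in> linfty"
proof -
  have "norm (ulim q (F x)) \<le> M" for x
    using ulim_norm_le[OF q, of "F x" 0 M] bd by (auto simp: linfty_iff)
  then show ?thesis by (auto simp: linfty_iff)
qed

lemma ulim_add:
  assumes "p \<in> ultrafilters" "f \<in> linfty" "g \<in> linfty"
  shows "ulim p (\<lambda>x. f x + g x) = ulim p f + ulim p g"
  by (intro ulim_eqI tendsto_add tendsto_ulim assms)

lemma ulim_mult:
  assumes "p \<in> ultrafilters" "f \<in> linfty" "g \<in> linfty"
  shows "ulim p (\<lambda>x. f x * g x) = ulim p f * ulim p g"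
  by (intro ulim_eqI tendsto_mult tendsto_ulim assms)

lemma ulim_const: "p \<in> ultrafilters \<Longrightarrow> ulim p (\<lambda>x. c) = c"
  by (intro ulim_eqI tendsto_const)

lemma ulim_cong:
  assumes p: "p \<in> ultrafilters" and f: "f \<in> linfty" "eventually (\<lambda>x. f x = g x) (ufilter p)"
  shows "ulim p g = ulim p f"
  by (rule ulim_eqI[OF p]) (use tendsto_cong[OF f(2)] tendsto_ulim[OF p f(1)] in blast)

lemma ulim_principal: "ulim (principal x) f = f x"
proof (rule ulim_eqI[OF principal_ultrafilter], rule topological_tendstoI)
  fix S assume "open S" "f x \<in> S"
  then show "eventually (\<lambda>y. f y \<in> S) (ufilter (principal x))"
    by (simp add: eventually_ufilter[OF principal_ultrafilter]) (simp add: principal_def)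
qed

lemma ulim_indicator:
  assumes p: "p \<in> ultrafilters"
  shows "ulim p (indicator A) = (if A \<in> p then 1 else 0)"
proof (cases "A \<in> p")
  case True
  then have "eventually (\<lambda>x. 1 = indicator A x) (ufilter p)"
    unfolding eventually_ufilter[OF p] by (rule ultrafilters_mono[OF p]) auto
  then show ?thesis using ulim_cong[OF p linfty_const, of 1 "indicator A"] True ulim_const[OF p] by simp
next
  case False
  then have "- A \<in> p" using ultrafilters_dichotomy[OF p] by blast
  then have "eventually (\<lambda>x. 0 = indicator A x) (ufilter p)"
    unfolding eventually_ufilter[OF p] by (rule ultrafilters_mono[OF p]) auto
  then show ?thesis using ulim_cong[OF p linfty_const, of 0 "indicator A"] False ulim_const[OF p] by simp
qed

text \<open>The image ultrafilter, the value at \<open>p\<close> of the extension of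
  \<open>g\<close>. It serves to translate ultrafilters on the group and to carry ultrafilters on
  \<open>nat\<close> along sequences into the group.\<close>

definition ultra_map :: "('a \<Rightarrow> 'b) \<Rightarrow> 'a set set \<Rightarrow> 'b set set" where
  "ultra_map g p = {A. g -` A \<in> p}"

lemma ultra_map_ultrafilter:
  assumes p: "p \<in> ultrafilters"
  shows "ultra_map g p \<in> ultrafilters"
  unfolding ultra_map_def ultrafilters_def
  using ultrafilters_UNIV[OF p] ultrafilters_empty[OF p] ultrafilters_Compl_iff[OF p]
    ultrafilters_Int[OF p] ultrafilters_mono[OF p _ vimage_mono]
  by (auto simp: vimage_Compl)

lemma ufilter_ultra_map:
  assumes p: "p \<in> ultrafilters"
  shows "ufilter (ultra_map g p) = filtermap g (ufilter p)"
proof (rule filter_eqI)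
  fix P
  have "eventually P (ufilter (ultra_map g p)) \<longleftrightarrow> {x. P x} \<in> ultra_map g p"
    by (rule eventually_ufilter[OF ultra_map_ultrafilter[OF p]])
  then show "eventually P (ufilter (ultra_map g p)) \<longleftrightarrow> eventually P (filtermap g (ufilter p))"
    by (simp add: eventually_filtermap eventually_ufilter[OF p] ultra_map_def vimage_def)
qed

lemma ulim_ultra_map:
  assumes p: "p \<in> ultrafilters" and f: "f \<in> linfty"
  shows "ulim (ultra_map g p) f = ulim p (\<lambda>x. f (g x))"
proof (rule ulim_eqI[symmetric, OF p])
  show "((\<lambda>x. f (g x)) \<longlongrightarrow> ulim (ultra_map g p) f) (ufilter p)"
    using tendsto_ulim[OF ultra_map_ultrafilter[OF p] f, of g]
    by (simp add: ufilter_ultra_map[OF p] filterlim_filtermap)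
qed

section \<open>The products of ultrafilters\<close>

text \<open>Translated sets become sections of the relation \<open>x + y \<in> A\<close>, so that
  membership in a product reads as two nested ultrafilter quantifiers, here with \<open>q\<close>
  inside.\<close>

lemma mem_ultra_mult_R: "A \<in> ultra_mult_R p q \<longleftrightarrow> {x. {y. x + y \<in> A} \<in> q} \<in> p"
proof -
  have "(\<lambda>a. - x + a) ` A = {y. x + y \<in> A}" for x :: 'a
    by (force simp: image_iff)
  then show ?thesis by (simp add: ultra_mult_R_def)
qed

lemma mem_ultra_mult_L: "A \<in> ultra_mult_L p q \<longleftrightarrow> {y. {x. x + y \<in> A} \<in> p} \<in> q"
proof -
  have "(\<lambda>a. a + - y) ` A = {x. x + y \<in> A}" for y :: 'a
  proof (intro equalityI subsetI)
    fix x assume "x \<in> {x. x + y \<in> A}"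
    then show "x \<in> (\<lambda>a. a + - y) ` A" by (intro image_eqI[of _ _ "x + y"]) (auto simp: add.assoc)
  qed (auto simp: add.assoc)
  then show ?thesis by (simp add: ultra_mult_L_def)
qed

lemma ultra_mult_R_ultrafilter:
  assumes p: "p \<in> ultrafilters" and q: "q \<in> ultrafilters"
  shows "ultra_mult_R p q \<in> ultrafilters"
  unfolding ultrafilters_def mem_Collect_eq mem_ultra_mult_R
proof (intro conjI allI impI)
  fix A B :: "'a set"
  show "{x. {y. x + y \<in> A \<inter> B} \<in> q} \<in> p" if "{x. {y. x + y \<in> A} \<in> q} \<in> p" "{x. {y. x + y \<in> B} \<in> q} \<in> p"
    using ultrafilters_Int[OF p that] by (simp add: Collect_conj_eq ultrafilters_Int_iff[OF q])
  show "{x. {y. x + y \<in> B} \<in> q} \<in> p" if "{x. {y. x + y \<in> A} \<in> q} \<in> p" "A \<subseteq> B"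
    by (rule ultrafilters_mono[OF p that(1)]) (use that(2) in \<open>auto elim!: ultrafilters_mono[OF q]\<close>)
  show "{x. {y. x + y \<in> A} \<in> q} \<in> p \<or> {x. {y. x + y \<in> - A} \<in> q} \<in> p"
    using ultrafilters_dichotomy[OF p, of "{x. {y. x + y \<in> A} \<in> q}"]
    by (simp add: Collect_neg_eq ultrafilters_Compl_iff[OF q])
qed (use ultrafilters_UNIV[OF p] ultrafilters_UNIV[OF q] ultrafilters_empty[OF p] ultrafilters_empty[OF q] in auto)

lemma ultra_mult_L_ultrafilter:
  assumes p: "p \<in> ultrafilters" and q: "q \<in> ultrafilters"
  shows "ultra_mult_L p q \<in> ultrafilters"
  unfolding ultrafilters_def mem_Collect_eq mem_ultra_mult_L
proof (intro conjI allI impI)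
  fix A B :: "'a set"
  show "{y. {x. x + y \<in> A \<inter> B} \<in> p} \<in> q" if "{y. {x. x + y \<in> A} \<in> p} \<in> q" "{y. {x. x + y \<in> B} \<in> p} \<in> q"
    using ultrafilters_Int[OF q that] by (simp add: Collect_conj_eq ultrafilters_Int_iff[OF p])
  show "{y. {x. x + y \<in> B} \<in> p} \<in> q" if "{y. {x. x + y \<in> A} \<in> p} \<in> q" "A \<subseteq> B"
    by (rule ultrafilters_mono[OF q that(1)]) (use that(2) in \<open>auto elim!: ultrafilters_mono[OF p]\<close>)
  show "{y. {x. x + y \<in> A} \<in> p} \<in> q \<or> {y. {x. x + y \<in> - A} \<in> p} \<in> q"
    using ultrafilters_dichotomy[OF q, of "{y. {x. x + y \<in> A} \<in> p}"]
    by (simp add: Collect_neg_eq ultrafilters_Compl_iff[OF p])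
qed (use ultrafilters_UNIV[OF p] ultrafilters_UNIV[OF q] ultrafilters_empty[OF p] ultrafilters_empty[OF q] in auto)

lemma ultra_mult_R_assoc: "ultra_mult_R (ultra_mult_R p q) r = ultra_mult_R p (ultra_mult_R q r)"
  by (auto simp: mem_ultra_mult_R add.assoc)

lemma ultra_mult_R_principal: "ultra_mult_R (principal x) (principal y) = principal (x + y)"
  by (auto simp: mem_ultra_mult_R principal_def)

text \<open>Nearness of \<open>f\<close> to its limit along the product is a nested statement, which
  passes to the inner limit along \<open>q\<close> for \<open>p\<close>-almost all
  \<open>x\<close>.\<close>

lemma ulim_ultra_mult_R:
  assumes p: "p \<in> ultrafilters" and q: "q \<in> ultrafilters" and f: "f \<in> linfty"
  shows "ulim (ultra_mult_R p q) f = ulim p (\<lambda>x. ulim q (\<lambda>y. f (x + y)))"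
proof (rule ulim_eqI[symmetric, OF p], rule tendstoI)
  fix e :: real assume e: "e > 0"
  let ?l = "ulim (ultra_mult_R p q) f"
  note r = ultra_mult_R_ultrafilter[OF p q]
  \<comment> \<open>Half of \<open>e\<close>, because the inner limit inherits only a non-strict
    bound.\<close>
  have "eventually (\<lambda>x. dist (f x) ?l < e / 2) (ufilter (ultra_mult_R p q))"
    using e by (intro tendstoD[OF tendsto_ulim[OF r f]]) simp
  then have "{x. {y. dist (f (x + y)) ?l < e / 2} \<in> q} \<in> p"
    unfolding eventually_ufilter[OF r] mem_ultra_mult_R by simp
  then have "eventually (\<lambda>x. eventually (\<lambda>y. dist (f (x + y)) ?l < e / 2) (ufilter q)) (ufilter p)"
    by (simp add: eventually_ufilter p q)
  then show "eventually (\<lambda>x. dist (ulim q (\<lambda>y. f (x + y))) ?l < e) (ufilter p)"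
  proof eventually_elim
    case (elim x)
    have "norm (ulim q (\<lambda>y. f (x + y)) - ?l) \<le> e / 2"
      by (rule ulim_norm_le[OF q linfty_comp[OF f]])
         (use elim in eventually_elim, simp add: dist_norm)
    then show ?case using e by (simp add: dist_norm)
  qed
qed

text \<open>Here \<open>p\<close> is inside. Equality of the values of \<open>f\<close> at both
  products is thus an interchange of iterated limits.\<close>

lemma ulim_ultra_mult_L:
  assumes p: "p \<in> ultrafilters" and q: "q \<in> ultrafilters" and f: "f \<in> linfty"
  shows "ulim (ultra_mult_L p q) f = ulim q (\<lambda>y. ulim p (\<lambda>x. f (x + y)))"
proof (rule ulim_eqI[symmetric, OF q], rule tendstoI)
  fix e :: real assume e: "e > 0"
  let ?l = "ulim (ultra_mult_L p q) f"
  note r = ultra_mult_L_ultrafilter[OF p q]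
  have "eventually (\<lambda>x. dist (f x) ?l < e / 2) (ufilter (ultra_mult_L p q))"
    using e by (intro tendstoD[OF tendsto_ulim[OF r f]]) simp
  then have "{y. {x. dist (f (x + y)) ?l < e / 2} \<in> p} \<in> q"
    unfolding eventually_ufilter[OF r] mem_ultra_mult_L by simp
  then have "eventually (\<lambda>y. eventually (\<lambda>x. dist (f (x + y)) ?l < e / 2) (ufilter p)) (ufilter q)"
    by (simp add: eventually_ufilter p q)
  then show "eventually (\<lambda>y. dist (ulim p (\<lambda>x. f (x + y))) ?l < e) (ufilter q)"
  proof eventually_elim
    case (elim y)
    have "norm (ulim p (\<lambda>x. f (x + y)) - ?l) \<le> e / 2"
      by (rule ulim_norm_le[OF p linfty_comp[OF f]])
         (use elim in eventually_elim, simp add: dist_norm)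
    then show ?case using e by (simp add: dist_norm)
  qed
qed

text \<open>By cancellation every section of \<open>{z}\<close> is a singleton, hence not a member
  of the free ultrafilter \<open>q\<close>.\<close>

lemma ultra_mult_R_remainder:
  fixes p q :: "'a::group_add set set"
  assumes p: "p \<in> beta_remainder" and q: "q \<in> beta_remainder"
  shows "ultra_mult_R p q \<in> beta_remainder"
  unfolding beta_remainder_iff
proof (intro conjI allI)
  note pq = p[THEN beta_remainder_ultrafilter] q[THEN beta_remainder_ultrafilter]
  show "ultra_mult_R p q \<in> ultrafilters" by (rule ultra_mult_R_ultrafilter[OF pq])
  fix z
  have "{y. x + y = z} = {- x + z}" for x :: 'a by auto
  then show "{z} \<notin> ultra_mult_R p q"
    using q ultrafilters_empty[OF pq(1)] by (simp add: mem_ultra_mult_R beta_remainder_iff)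
qed

lemma ultra_mult_L_remainder:
  fixes p q :: "'a::group_add set set"
  assumes p: "p \<in> beta_remainder" and q: "q \<in> beta_remainder"
  shows "ultra_mult_L p q \<in> beta_remainder"
  unfolding beta_remainder_iff
proof (intro conjI allI)
  note pq = p[THEN beta_remainder_ultrafilter] q[THEN beta_remainder_ultrafilter]
  show "ultra_mult_L p q \<in> ultrafilters" by (rule ultra_mult_L_ultrafilter[OF pq])
  fix z
  have "{x. x + y = z} = {z - y}" for y :: 'a by auto
  then show "{z} \<notin> ultra_mult_L p q"
    using p ultrafilters_empty[OF pq(2)] by (simp add: mem_ultra_mult_L beta_remainder_iff)
qed

section \<open>The topology of the Stone--Cech compactification\<close>

lemma topspace_beta: "topspace beta_topology = ultrafilters"
  unfolding beta_topology_def topology_generated_by_topspace by (auto dest: ultrafilters_UNIV)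

lemma openin_beta_basic: "openin beta_topology {p \<in> ultrafilters. A \<in> p}"
  unfolding beta_topology_def by (rule topology_generated_by_Basis) blast

text \<open>The generating sets are closed under binary intersection, since \<open>A\<close> and
  \<open>B\<close> both belong to \<open>q\<close> iff \<open>A \<inter> B\<close> does; so they
  form a base and not merely a subbase.\<close>

lemma openin_beta_iff:
  "openin beta_topology U \<longleftrightarrow> U \<subseteq> ultrafilters \<and> (\<forall>p\<in>U. \<exists>A\<in>p. {q \<in> ultrafilters. A \<in> q} \<subseteq> U)"
  (is "_ \<longleftrightarrow> ?R U")
proof
  assume "openin beta_topology U"
  then have "generate_topology_on {{p \<in> ultrafilters. A \<in> p} | A. True} U"
    by (simp add: beta_topology_def openin_topology_generated_by_iff)
  then show "?R U"
  proof induction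
    case (Int U V)
    have "\<exists>A\<in>p. {q \<in> ultrafilters. A \<in> q} \<subseteq> U \<inter> V" if "p \<in> U \<inter> V" for p
    proof -
      have "p \<in> U" "p \<in> V" using that by simp_all
      from bspec[OF conjunct2[OF Int.IH(1)] this(1)] bspec[OF conjunct2[OF Int.IH(2)] this(2)]
      obtain A B where AB: "A \<in> p" "B \<in> p" "{q \<in> ultrafilters. A \<in> q} \<subseteq> U" "{q \<in> ultrafilters. B \<in> q} \<subseteq> V"
        by (elim bexE)
      have "p \<in> ultrafilters" using conjunct1[OF Int.IH(1)] \<open>p \<in> U\<close> by (rule subsetD)
      with AB show ?thesis by (intro bexI[of _ "A \<inter> B"]) (auto simp: ultrafilters_Int_iff)
    qed
    moreover have "U \<inter> V \<subseteq> ultrafilters" using conjunct1[OF Int.IH(1)] by (rule le_infI1)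
    ultimately show ?case by simp
  next
    case (UN K)
    show ?case
    proof (intro conjI ballI)
      show "\<Union>K \<subseteq> ultrafilters" using UN.IH by (simp add: Sup_le_iff)
      fix p assume "p \<in> \<Union>K"
      then obtain k where k: "k \<in> K" "p \<in> k" by (rule UnionE)
      from bspec[OF conjunct2[OF UN.IH[OF k(1)]] k(2)]
      obtain A where "A \<in> p" "{q \<in> ultrafilters. A \<in> q} \<subseteq> k" by (rule bexE)
      then show "\<exists>A\<in>p. {q \<in> ultrafilters. A \<in> q} \<subseteq> \<Union>K" using k(1) by (intro bexI[of _ A]) auto
    qed
  next
    case (Basis s)
    then obtain A where "s = {p \<in> ultrafilters. A \<in> p}" by auto
    then show ?case by auto
  qed simp
next
  assume R: "?R U"
  have "U = \<Union>{{q \<in> ultrafilters. A \<in> q} | A. {q \<in> ultrafilters. A \<in> q} \<subseteq> U}"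
    using R by blast
  moreover have "openin beta_topology (\<Union>{{q \<in> ultrafilters. A \<in> q} | A. {q \<in> ultrafilters. A \<in> q} \<subseteq> U})"
    using openin_beta_basic by blast
  ultimately show "openin beta_topology U" by simp
qed

text \<open>For a cover without finite subcover, take the complements of all \<open>A\<close> whose
  basic open set lies inside one member of the cover. They have the finite intersection property,
  and an ultrafilter containing them all lies in no member.\<close>

lemma compact_space_beta: "compact_space beta_topology"
proof -
  have fin: "\<exists>\<F>. finite \<F> \<and> \<F> \<subseteq> \<U> \<and> ultrafilters \<subseteq> \<Union>\<F>"
    if op: "\<And>U. U \<in> \<U> \<Longrightarrow> openin beta_topology U" and cov: "ultrafilters \<subseteq> \<Union>\<U>"
    for \<U> :: "'a set set set set"
  proof (rule ccontr)
    assume neg: "\<not> ?thesis"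
    let ?B = "{- A | A. \<exists>U\<in>\<U>. {q \<in> ultrafilters. A \<in> q} \<subseteq> U}"
    have "\<exists>p\<in>ultrafilters. ?B \<subseteq> p"
    proof (rule ultrafilter_extends_FIP)
      fix \<F> assume F: "finite \<F>" "\<F> \<subseteq> ?B"
      have small: "\<exists>U\<in>\<U>. {q \<in> ultrafilters. - C \<in> q} \<subseteq> U" if "C \<in> ?B" for C
      proof -
        from that obtain A where "C = - A" "\<exists>U\<in>\<U>. {q \<in> ultrafilters. A \<in> q} \<subseteq> U"
          by (elim CollectE exE conjE)
        then show ?thesis by simp
      qed
      have "\<forall>C\<in>\<F>. \<exists>U\<in>\<U>. {q \<in> ultrafilters. - C \<in> q} \<subseteq> U"
        by (intro ballI small subsetD[OF F(2)])
      from bchoice[OF this[unfolded Bex_def]]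
      obtain u where u: "\<And>C. C \<in> \<F> \<Longrightarrow> u C \<in> \<U>" "\<And>C. C \<in> \<F> \<Longrightarrow> {q \<in> ultrafilters. - C \<in> q} \<subseteq> u C"
        by auto
      have "\<not> ultrafilters \<subseteq> \<Union>(u ` \<F>)"
      proof
        assume "ultrafilters \<subseteq> \<Union>(u ` \<F>)"
        moreover have "finite (u ` \<F>)" "u ` \<F> \<subseteq> \<U>" using F(1) u(1) by auto
        ultimately show False using neg by blast
      qed
      then obtain p where p: "p \<in> ultrafilters" "p \<notin> \<Union>(u ` \<F>)" by blast
      have "C \<in> p" if "C \<in> \<F>" for C using u(2)[OF that] p that ultrafilters_dichotomy[OF p(1), of C] by blast
      with F(1) have "\<Inter>\<F> \<in> p" by (induction \<F>) (auto simp: ultrafilters_UNIV[OF p(1)] ultrafilters_Int_iff[OF p(1)])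
      then show "\<Inter>\<F> \<noteq> {}" using ultrafilters_empty[OF p(1)] by auto
    qed
    then obtain p where p: "p \<in> ultrafilters" "?B \<subseteq> p" by blast
    obtain U where U: "U \<in> \<U>" "p \<in> U" using subsetD[OF cov p(1)] by (rule UnionE)
    have "\<exists>A\<in>p. {q \<in> ultrafilters. A \<in> q} \<subseteq> U"
      using op[OF U(1)] U(2) unfolding openin_beta_iff by simp
    then obtain A where A: "A \<in> p" "{q \<in> ultrafilters. A \<in> q} \<subseteq> U" by (rule bexE)
    then have "- A \<in> ?B" using U(1) by (intro CollectI exI[of _ A] conjI refl bexI[of _ U])
    then have "- A \<in> p" using p(2) by (rule rev_subsetD)
    then show False using A(1) ultrafilters_Compl_iff[OF p(1)] by simp
  qed
  then show ?thesis by (simp add: compact_space_def compactin_def topspace_beta)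
qed

lemma beta_closure_principal: "beta_topology closure_of (range principal) = ultrafilters"
proof -
  have "\<exists>y\<in>range principal. y \<in> U" if "p \<in> U" "openin beta_topology U" for p :: "'a set set" and U
  proof -
    from that(2) have U: "U \<subseteq> ultrafilters" "\<forall>p\<in>U. \<exists>A\<in>p. {q \<in> ultrafilters. A \<in> q} \<subseteq> U"
      unfolding openin_beta_iff by simp_all
    have p: "p \<in> ultrafilters" using U(1) that(1) by (rule subsetD)
    from bspec[OF U(2) that(1)] obtain A where A: "A \<in> p" "{q \<in> ultrafilters. A \<in> q} \<subseteq> U"
      by (rule bexE)
    obtain x where "x \<in> A" using A(1) ultrafilters_empty[OF p] by (cases "A = {}") auto
    then have "principal x \<in> {q \<in> ultrafilters. A \<in> q}"
      by (simp add: principal_ultrafilter) (simp add: principal_def)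
    then show ?thesis using A(2) by (intro bexI[of _ "principal x"] rangeI) (rule subsetD)
  qed
  then show ?thesis unfolding closure_of_def topspace_beta by auto
qed

lemma continuous_map_ulim:
  assumes f: "f \<in> linfty"
  shows "continuous_map beta_topology euclidean (\<lambda>p. ulim p f)"
  unfolding continuous_map_def openin_beta_iff topspace_beta
proof (intro conjI allI impI ballI)
  fix U :: "complex set" and p assume U: "openin euclidean U" and "p \<in> {p \<in> ultrafilters. ulim p f \<in> U}"
  then have p: "p \<in> ultrafilters" "ulim p f \<in> U" by auto
  \<comment> \<open>A closed ball, since limits preserve non-strict bounds only.\<close>
  then obtain e where e: "e > 0" "cball (ulim p f) e \<subseteq> U" using U open_contains_cball by (metis open_openin)
  have "eventually (\<lambda>x. norm (f x - ulim p f) \<le> e) (ufilter p)"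
    using tendstoD[OF tendsto_ulim[OF p(1) f] e(1)] by eventually_elim (simp add: dist_norm)
  then have mem: "{x. norm (f x - ulim p f) \<le> e} \<in> p" by (simp add: eventually_ufilter[OF p(1)])
  have "ulim q f \<in> U" if q: "q \<in> ultrafilters" "{x. norm (f x - ulim p f) \<le> e} \<in> q" for q
    using ulim_norm_le[OF q(1) f, of "ulim p f" e] q e(2)
    by (auto simp: eventually_ufilter dist_norm norm_minus_commute)
  then show "\<exists>A\<in>p. {q \<in> ultrafilters. A \<in> q} \<subseteq> {p \<in> ultrafilters. ulim p f \<in> U}"
    by (intro bexI[OF _ mem]) auto
qed auto

lemma continuous_map_beta_iff:
  fixes f :: "'b \<Rightarrow> 'a set set"
  shows "continuous_map X beta_topology f \<longleftrightarrow>
    f ` topspace X \<subseteq> ultrafilters \<and> (\<forall>A. openin X {x \<in> topspace X. A \<in> f x})"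
  (is "_ \<longleftrightarrow> ?R")
proof
  assume f: "continuous_map X beta_topology f"
  then have sub: "f ` topspace X \<subseteq> ultrafilters"
    using continuous_map_image_subset_topspace topspace_beta by metis
  moreover have "openin X {x \<in> topspace X. A \<in> f x}" for A
  proof -
    have "openin X {x \<in> topspace X. f x \<in> {p \<in> ultrafilters. A \<in> p}}"
      by (rule openin_continuous_map_preimage[OF f openin_beta_basic])
    moreover have "{x \<in> topspace X. f x \<in> {p \<in> ultrafilters. A \<in> p}} = {x \<in> topspace X. A \<in> f x}"
      using sub by blast
    ultimately show ?thesis by simp
  qed
  ultimately show ?R by blast
next
  assume R: ?R
  show "continuous_map X beta_topology f"
    unfolding beta_topology_def
  proof (rule continuous_on_generated_topo)
    fix U :: "'a set set set" assume "U \<in> {{p \<in> ultrafilters. A \<in> p} | A. True}"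
    then obtain A where "U = {p \<in> ultrafilters. A \<in> p}" by blast
    then have "f -` U \<inter> topspace X = {x \<in> topspace X. A \<in> f x}" using R by blast
    then show "openin X (f -` U \<inter> topspace X)" using R by simp
  next
    show "f ` topspace X \<subseteq> \<Union> {{p \<in> ultrafilters. A \<in> p} | A. True}"
      using R by (auto dest: ultrafilters_UNIV)
  qed
qed

text \<open>The preimage of a basic open set is again basic: \<open>A\<close> belongs to
  \<open>pq\<close> iff a set depending only on \<open>A\<close> and \<open>q\<close> belongs to
  \<open>p\<close>.\<close>

lemma continuous_map_ultra_mult_R:
  assumes q: "q \<in> ultrafilters"
  shows "continuous_map beta_topology beta_topology (\<lambda>p. ultra_mult_R p q)"
  unfolding continuous_map_beta_iff topspace_beta mem_ultra_mult_R
  using ultra_mult_R_ultrafilter[OF _ q] openin_beta_basic by auto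

lemma continuous_map_ultra_mult_L:
  assumes p: "p \<in> ultrafilters"
  shows "continuous_map beta_topology beta_topology (\<lambda>q. ultra_mult_L p q)"
  unfolding continuous_map_beta_iff topspace_beta mem_ultra_mult_L
  using ultra_mult_L_ultrafilter[OF p] openin_beta_basic by auto

section \<open>The double limit criterion\<close>

text \<open>Grothendieck's condition with ultrafilters in place of sequences: the iterated limits of
  \<open>f (x + y)\<close> along \<open>p\<close> and \<open>q\<close> agree in both orders.\<close>

definition double_limit :: "('a::group_add \<Rightarrow> complex) \<Rightarrow> bool" where
  "double_limit f \<longleftrightarrow> f \<in> linfty \<and>
    (\<forall>p\<in>ultrafilters. \<forall>q\<in>ultrafilters. ulim (ultra_mult_R p q) f = ulim (ultra_mult_L p q) f)"

section \<open>Bounded functionals and the weak topology\<close>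

lemma norm_le_linfty_norm: "f \<in> linfty \<Longrightarrow> norm (f x) \<le> linfty_norm f"
  unfolding linfty_norm_def linfty_iff by (rule cSUP_upper) (auto intro: bdd_aboveI2)

lemma linfty_norm_le: "(\<And>x. norm (f x) \<le> M) \<Longrightarrow> linfty_norm f \<le> M"
  unfolding linfty_norm_def by (rule cSUP_least) auto

lemma linfty_dual_add:
  "\<Phi> \<in> linfty_dual \<Longrightarrow> f \<in> linfty \<Longrightarrow> g \<in> linfty \<Longrightarrow> \<Phi> (\<lambda>x. f x + g x) = \<Phi> f + \<Phi> g"
  and linfty_dual_scale: "\<Phi> \<in> linfty_dual \<Longrightarrow> f \<in> linfty \<Longrightarrow> \<Phi> (\<lambda>x. c * f x) = c * \<Phi> f"
  by (simp_all add: linfty_dual_def)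

lemma linfty_dual_diff:
  assumes \<Phi>: "\<Phi> \<in> linfty_dual" and f: "f \<in> linfty" and g: "g \<in> linfty"
  shows "\<Phi> (\<lambda>x. f x - g x) = \<Phi> f - \<Phi> g"
  using linfty_dual_add[OF \<Phi> linfty_diff[OF f g] g] by simp

text \<open>The constant in \<open>linfty_dual\<close> may have any sign; passing to its absolute
  value allows an arbitrary pointwise bound \<open>M\<close> in place of the norm.\<close>

lemma linfty_dual_bound:
  assumes \<Phi>: "\<Phi> \<in> linfty_dual"
  obtains C where "C \<ge> 0" "\<And>f M. (\<And>x. norm (f x) \<le> M) \<Longrightarrow> norm (\<Phi> f) \<le> C * M"
proof -
  from \<Phi> obtain C where C: "\<forall>f\<in>linfty. norm (\<Phi> f) \<le> C * linfty_norm f"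
    unfolding linfty_dual_def by blast
  have "norm (\<Phi> f) \<le> \<bar>C\<bar> * M" if bd: "\<And>x. norm (f x) \<le> M" for f M
  proof -
    have f: "f \<in> linfty" using bd by (auto simp: linfty_iff)
    then have "norm (\<Phi> f) \<le> C * linfty_norm f" using C by blast
    also have "\<dots> \<le> \<bar>C\<bar> * linfty_norm f"
      using order_trans[OF norm_ge_zero norm_le_linfty_norm[OF f]] by (intro mult_right_mono) auto
    also have "\<dots> \<le> \<bar>C\<bar> * M" by (intro mult_left_mono linfty_norm_le bd) auto
    finally show ?thesis .
  qed
  then show ?thesis using that[of "\<bar>C\<bar>"] by simp
qed

text \<open>Provides enough functionals: those at principal ultrafilters are evaluations and
  separate functions, those at a general \<open>q\<close> give the outer limit of an iterated
  limit.\<close>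

lemma ulim_in_linfty_dual:
  assumes p: "p \<in> ultrafilters"
  shows "ulim p \<in> linfty_dual"
proof -
  have "norm (ulim p f) \<le> 1 * linfty_norm f" if f: "f \<in> linfty" for f
    using ulim_norm_le[OF p f, of 0 "linfty_norm f"] norm_le_linfty_norm[OF f] by simp
  then show ?thesis
    unfolding linfty_dual_def
    using ulim_add[OF p] ulim_mult[OF p linfty_const] ulim_const[OF p]
    by (auto intro!: exI[of _ 1])
qed

lemma openin_linfty_weak:
  "\<Phi> \<in> linfty_dual \<Longrightarrow> open U \<Longrightarrow> openin linfty_weak_topology {f \<in> linfty. \<Phi> f \<in> U}"
  unfolding linfty_weak_topology_def by (rule topology_generated_by_Basis) auto

lemma topspace_linfty_weak: "topspace linfty_weak_topology = linfty"
proof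
  show "topspace linfty_weak_topology \<subseteq> linfty"
    unfolding linfty_weak_topology_def topology_generated_by_topspace by auto
  have "openin linfty_weak_topology {f \<in> linfty. ulim (principal undefined) f \<in> UNIV}"
    by (intro openin_linfty_weak ulim_in_linfty_dual principal_ultrafilter) simp
  then show "linfty \<subseteq> topspace linfty_weak_topology" using openin_subset by fastforce
qed

lemma continuous_map_linfty_weak:
  fixes g :: "'b \<Rightarrow> 'a \<Rightarrow> complex"
  assumes "\<And>x. x \<in> topspace X \<Longrightarrow> g x \<in> linfty"
    and "\<And>\<Phi>. \<Phi> \<in> linfty_dual \<Longrightarrow> continuous_map X euclidean (\<lambda>x. \<Phi> (g x))"
  shows "continuous_map X linfty_weak_topology g"
  unfolding linfty_weak_topology_def
proof (rule continuous_on_generated_topo)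
  fix U :: "('a \<Rightarrow> complex) set"
  assume "U \<in> {{f \<in> linfty. \<Phi> f \<in> U} | \<Phi> U. \<Phi> \<in> linfty_dual \<and> open U}"
  then obtain \<Phi> V where U: "U = {f \<in> linfty. \<Phi> f \<in> V}" "\<Phi> \<in> linfty_dual" "open V" by auto
  have "openin X {x \<in> topspace X. \<Phi> (g x) \<in> V}"
    using openin_continuous_map_preimage[OF assms(2)[OF U(2)]] U(3) by simp
  moreover have "g -` U \<inter> topspace X = {x \<in> topspace X. \<Phi> (g x) \<in> V}" using U(1) assms(1) by auto
  ultimately show "openin X (g -` U \<inter> topspace X)" by simp
next
  have "g ` topspace X \<subseteq> topspace linfty_weak_topology"
    using assms(1) by (auto simp: topspace_linfty_weak)
  then show "g ` topspace X \<subseteq> \<Union>{{f \<in> linfty. \<Phi> f \<in> U} | \<Phi> U. \<Phi> \<in> linfty_dual \<and> open U}"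
    by (simp only: linfty_weak_topology_def topology_generated_by_topspace)
qed

lemma Hausdorff_linfty_weak: "Hausdorff_space linfty_weak_topology"
  unfolding Hausdorff_space_def topspace_linfty_weak
proof (intro allI impI)
  fix f g :: "'a \<Rightarrow> complex" assume fg: "f \<in> linfty \<and> g \<in> linfty \<and> f \<noteq> g"
  then obtain x where "f x \<noteq> g x" by auto
  then obtain U V where UV: "open U" "open V" "f x \<in> U" "g x \<in> V" "U \<inter> V = {}"
    by (rule separation_t2[THEN iffD1, THEN exE]) auto
  let ?O = "\<lambda>U. {f \<in> linfty. ulim (principal x) f \<in> U}"
  have "openin linfty_weak_topology (?O U)" "openin linfty_weak_topology (?O V)"
    using UV by (intro openin_linfty_weak ulim_in_linfty_dual principal_ultrafilter; simp)+
  moreover have "f \<in> ?O U" "g \<in> ?O V" "disjnt (?O U) (?O V)"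
    using fg UV by (auto simp: ulim_principal disjnt_def)
  ultimately show "\<exists>U V. openin linfty_weak_topology U \<and> openin linfty_weak_topology V \<and>
      f \<in> U \<and> g \<in> V \<and> disjnt U V" by meson
qed

lemma orbit_subset_linfty: "f \<in> linfty \<Longrightarrow> orbit f \<subseteq> linfty"
  by (auto simp: orbit_def linfty_comp)

text \<open>Compactness yields a weak cluster point \<open>h\<close> of the translates, which is a
  weak limit since \<open>p\<close> is an ultrafilter. Evaluations identify \<open>h\<close> as the
  pointwise limit along \<open>p\<close>; the functional \<open>ulim q\<close> applied to this weak
  limit then exchanges the two limits.\<close>

lemma WAP_imp_double_limit:
  assumes "f \<in> WAP"
  shows "double_limit f"
  unfolding double_limit_def
proof (intro conjI ballI)
  let ?K = "linfty_weak_topology closure_of orbit f"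
  show f: "f \<in> linfty" using assms by (simp add: WAP_def)
  fix p q :: "'a set set" assume p: "p \<in> ultrafilters" and q: "q \<in> ultrafilters"
  have K: "compactin linfty_weak_topology ?K" using assms by (simp add: WAP_def)
  have orb: "orbit f \<subseteq> ?K"
    by (rule closure_of_subset) (simp add: topspace_linfty_weak orbit_subset_linfty f)
  have "\<exists>h\<in>?K. \<forall>W. openin linfty_weak_topology W \<longrightarrow> h \<in> W \<longrightarrow> {\<gamma>. (\<lambda>x. f (\<gamma> + x)) \<in> W} \<in> p"
  proof (rule ccontr)
    \<comment> \<open>If every point of the compact set had a neighbourhood visited only on a set
      outside \<open>p\<close>, finitely many such sets would cover the group, and one of them would
      belong to \<open>p\<close>.\<close>
    assume neg: "\<not> ?thesis"
    define \<U> where "\<U> = {W. openin linfty_weak_topology W \<and> {\<gamma>. (\<lambda>x. f (\<gamma> + x)) \<in> W} \<notin> p}"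
    have "?K \<subseteq> \<Union>\<U>" using neg unfolding \<U>_def by blast
    moreover have "\<forall>U\<in>\<U>. openin linfty_weak_topology U" by (simp add: \<U>_def)
    ultimately obtain \<F> where F: "finite \<F>" "\<F> \<subseteq> \<U>" "?K \<subseteq> \<Union>\<F>"
      using K unfolding compactin_def by metis
    have "(\<Union>W\<in>\<F>. {\<gamma>. (\<lambda>x. f (\<gamma> + x)) \<in> W}) = UNIV"
    proof (intro equalityI subsetI)
      fix \<gamma> :: 'a
      have "(\<lambda>x. f (\<gamma> + x)) \<in> \<Union>\<F>" using orb F(3) by (auto simp: orbit_def)
      then show "\<gamma> \<in> (\<Union>W\<in>\<F>. {\<gamma>. (\<lambda>x. f (\<gamma> + x)) \<in> W})" by simp
    qed simp
    then have "\<exists>W\<in>\<F>. {\<gamma>. (\<lambda>x. f (\<gamma> + x)) \<in> W} \<in> p"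
      using ultrafilters_UN_finite[OF p F(1)] ultrafilters_UNIV[OF p] by simp
    then show False using F(2) by (auto simp: \<U>_def)
  qed
  then obtain h where hK: "h \<in> ?K"
    and h: "\<And>W. openin linfty_weak_topology W \<Longrightarrow> h \<in> W \<Longrightarrow> {\<gamma>. (\<lambda>x. f (\<gamma> + x)) \<in> W} \<in> p"
    by metis
  have hl: "h \<in> linfty" using subsetD[OF closure_of_subset_topspace hK] by (simp add: topspace_linfty_weak)
  have lim: "ulim p (\<lambda>\<gamma>. \<Phi> (\<lambda>x. f (\<gamma> + x))) = \<Phi> h" if \<Phi>: "\<Phi> \<in> linfty_dual" for \<Phi>
  proof (rule ulim_eqI[OF p], rule topological_tendstoI)
    fix S assume S: "open S" "\<Phi> h \<in> S"
    show "eventually (\<lambda>\<gamma>. \<Phi> (\<lambda>x. f (\<gamma> + x)) \<in> S) (ufilter p)"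
      using h[OF openin_linfty_weak[OF \<Phi> S(1)]] S(2) hl
      by (simp add: eventually_ufilter[OF p] linfty_comp[OF f])
  qed
  have "h y = ulim p (\<lambda>\<gamma>. f (\<gamma> + y))" for y
    using lim[OF ulim_in_linfty_dual[OF principal_ultrafilter[of y]]] by (simp add: ulim_principal)
  then have "h = (\<lambda>y. ulim p (\<lambda>\<gamma>. f (\<gamma> + y)))" by blast
  then show "ulim (ultra_mult_R p q) f = ulim (ultra_mult_L p q) f"
    using lim[OF ulim_in_linfty_dual[OF q]]
    by (simp add: ulim_ultra_mult_R[OF p q f] ulim_ultra_mult_L[OF p q f])
qed

text \<open>
  A substitute for dominated convergence: the unions \<open>D n\<close> of long blocks \<open>E n, \<dots>, E (m n)\<close>
  nearly exhaust the measure of all later unions, so they have the finite intersection property.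
\<close>

lemma additive_infinitely_often:
  fixes \<mu> :: "'a set \<Rightarrow> real" and E :: "nat \<Rightarrow> 'a set"
  assumes nonneg: "\<And>A. \<mu> A \<ge> 0"
    and additive: "\<And>A B. A \<inter> B = {} \<Longrightarrow> \<mu> (A \<union> B) = \<mu> A + \<mu> B"
    and \<delta>: "\<delta> > 0" "\<And>n. \<mu> (E n) \<ge> \<delta>"
  shows "\<exists>q\<in>ultrafilters. infinite {n. E n \<in> q}"
proof -
  have mono: "\<mu> A \<le> \<mu> B" if "A \<subseteq> B" for A B
    using additive[of A "B - A"] nonneg[of "B - A"] that by (simp add: Un_absorb1)
  have subadd: "\<mu> (A \<union> B) \<le> \<mu> A + \<mu> B" for A B
    using additive[of A "B - A"] mono[of "B - A" B] by simp
  have empty: "\<mu> {} = 0" using additive[of "{}" "{}"] by simp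
  have subadd_finite: "\<mu> (\<Union>i\<in>I. A i) \<le> (\<Sum>i\<in>I. \<mu> (A i))" if "finite I" for I :: "nat set" and A
    using that
  proof (induction I)
    case (insert i I)
    then show ?case using subadd[of "A i" "\<Union>i\<in>I. A i"] by simp
  qed (simp add: empty)
  define s where "s n = (SUP m. \<mu> (\<Union>i\<in>{n..m}. E i))" for n
  have upper: "\<mu> (\<Union>i\<in>{n..m}. E i) \<le> s n" for n m
    unfolding s_def by (rule cSUP_upper) (auto intro!: bdd_aboveI2[of _ _ "\<mu> UNIV"] mono)
  \<comment> \<open>The tolerances sum to less than \<open>\<delta> / 2\<close> over all
    \<open>n\<close>. Requiring \<open>m \<ge> n\<close> puts \<open>E n\<close> itself into its
    block.\<close>
  have "\<exists>m\<ge>n. s n - \<delta> / 2 ^ (n + 2) < \<mu> (\<Union>i\<in>{n..m}. E i)" for n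
  proof -
    have "\<exists>m. s n - \<delta> / 2 ^ (n + 2) < \<mu> (\<Union>i\<in>{n..m}. E i)"
    proof (rule ccontr)
      assume "\<not> ?thesis"
      then have "s n \<le> s n - \<delta> / 2 ^ (n + 2)"
        unfolding s_def by (intro cSUP_least) (auto simp: not_less)
      then show False using \<delta>(1) by (simp add: field_simps)
    qed
    then obtain m where m: "s n - \<delta> / 2 ^ (n + 2) < \<mu> (\<Union>i\<in>{n..m}. E i)" by blast
    also have "\<dots> \<le> \<mu> (\<Union>i\<in>{n..max n m}. E i)" by (rule mono) auto
    finally show ?thesis by (intro exI[of _ "max n m"]) simp
  qed
  then obtain m where m: "\<And>n. m n \<ge> n" "\<And>n. s n - \<delta> / 2 ^ (n + 2) < \<mu> (\<Union>i\<in>{n..m n}. E i)"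
    by metis
  define D where "D n = (\<Union>i\<in>{n..m n}. E i)" for n
  \<comment> \<open>For \<open>i \<le> j\<close> the block \<open>D j\<close> lies in the union of
    the sets from \<open>i\<close> onwards, whose finite parts have measure at most
    \<open>s i\<close>, and \<open>D i\<close> already has nearly that much.\<close>
  have small: "\<mu> (D j - D i) < \<delta> / 2 ^ (i + 2)" if "i \<le> j" for i j
  proof -
    have "\<mu> (D i) + \<mu> (D j - D i) = \<mu> (D i \<union> (D j - D i))" by (rule additive[symmetric]) auto
    also have "\<dots> \<le> \<mu> (\<Union>k\<in>{i..max (m i) (m j)}. E k)"
    proof (rule mono)
      have "D i \<subseteq> (\<Union>k\<in>{i..max (m i) (m j)}. E k)" "D j \<subseteq> (\<Union>k\<in>{i..max (m i) (m j)}. E k)"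
        unfolding D_def by (rule UN_mono; use that in auto)+
      then show "D i \<union> (D j - D i) \<subseteq> (\<Union>k\<in>{i..max (m i) (m j)}. E k)" by auto
    qed
    also have "\<dots> \<le> s i" by (rule upper)
    finally show ?thesis using m(2)[of i] by (simp add: D_def)
  qed
  have inter: "(\<Inter>i\<in>{..n}. D i) \<noteq> {}" for n
  proof
    \<comment> \<open>Each point of \<open>E n\<close> lies in \<open>D n\<close> but misses some
      earlier \<open>D i\<close>, so the small differences \<open>D n - D i\<close> would cover a
      set of measure at least \<open>\<delta>\<close>.\<close>
    assume e: "(\<Inter>i\<in>{..n}. D i) = {}"
    have "\<delta> \<le> \<mu> (E n)" by (rule \<delta>)
    also have "\<dots> \<le> \<mu> (\<Union>i\<in>{..n}. D n - D i)"
    proof (rule mono, rule subsetI)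
      fix x assume "x \<in> E n"
      then have "x \<in> D n" using m(1)[of n] by (auto simp: D_def)
      then show "x \<in> (\<Union>i\<in>{..n}. D n - D i)" using e by auto
    qed
    also have "\<dots> \<le> (\<Sum>i\<in>{..n}. \<mu> (D n - D i))" by (rule subadd_finite) simp
    also have "\<dots> \<le> (\<Sum>i\<in>{..n}. \<delta> / 2 ^ (i + 2))" by (rule sum_mono, rule less_imp_le, rule small) simp
    also have "\<dots> = \<delta> / 2 - \<delta> / 2 ^ (n + 2)" by (induction n) (simp_all add: field_simps)
    also have "\<dots> < \<delta>" using \<delta>(1) by (simp add: field_simps add_pos_pos)
    finally show False by simp
  qed
  have "\<exists>q\<in>ultrafilters. range (\<lambda>n. \<Inter>i\<in>{..n}. D i) \<subseteq> q"
  proof (rule ultrafilter_extends_directed)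
    fix A B assume "A \<in> range (\<lambda>n. \<Inter>i\<in>{..n}. D i)" "B \<in> range (\<lambda>n. \<Inter>i\<in>{..n}. D i)"
    then obtain a b where "A = (\<Inter>i\<in>{..a}. D i)" "B = (\<Inter>i\<in>{..b}. D i)" by auto
    then have "(\<Inter>i\<in>{..max a b}. D i) \<subseteq> A \<inter> B" by auto
    then show "\<exists>C\<in>range (\<lambda>n. \<Inter>i\<in>{..n}. D i). C \<subseteq> A \<inter> B" by (rule bexI) simp
  qed (use inter in \<open>auto simp: image_iff\<close>)
  then obtain q where q: "q \<in> ultrafilters" "\<And>n. (\<Inter>i\<in>{..n}. D i) \<in> q" by auto
  have "\<exists>i\<ge>n. E i \<in> q" for n
  proof -
    \<comment> \<open>A block is a finite union, so the ultrafilter selects one of its sets; its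
      index is at least \<open>n\<close>.\<close>
    have "D n \<in> q" by (rule ultrafilters_mono[OF q(1) q(2)[of n]]) auto
    then have "\<exists>i\<in>{n..m n}. E i \<in> q"
      unfolding D_def by (intro ultrafilters_UN_finite[OF q(1)]) simp_all
    then show ?thesis by auto
  qed
  then have "infinite {n. E n \<in> q}" unfolding infinite_nat_iff_unbounded_le by auto
  then show ?thesis using q(1) by blast
qed

text \<open>The variation of \<open>\<Phi>\<close> viewed as a finitely additive complex measure.
  Testing with all functions dominated by the indicator, not with the indicator alone, makes it
  additive and lets it control \<open>\<Phi>\<close> on every bounded function supported in
  \<open>A\<close>.\<close>

definition total_variation :: "(('a \<Rightarrow> complex) \<Rightarrow> complex) \<Rightarrow> 'a set \<Rightarrow> real" where
  "total_variation \<Phi> A = (SUP u\<in>{u. \<forall>x. norm (u x) \<le> indicator A x}. norm (\<Phi> u))"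

lemma indicator_dominated_linfty: "(\<And>x. norm (u x) \<le> indicator A x) \<Longrightarrow> u \<in> linfty"
  unfolding linfty_iff by (rule exI[of _ 1]) (auto intro: order_trans[OF _ indicator_le_1])

lemma total_variation_upper:
  assumes \<Phi>: "\<Phi> \<in> linfty_dual" and u: "\<And>x. norm (u x) \<le> indicator A x"
  shows "norm (\<Phi> u) \<le> total_variation \<Phi> A"
proof -
  obtain C where C: "C \<ge> 0" "\<And>f M. (\<And>x. norm (f x) \<le> M) \<Longrightarrow> norm (\<Phi> f) \<le> C * M"
    using linfty_dual_bound[OF \<Phi>] by blast
  show ?thesis
    unfolding total_variation_def
  proof (rule cSUP_upper)
    show "bdd_above ((\<lambda>u. norm (\<Phi> u)) ` {u. \<forall>x. norm (u x) \<le> indicator A x})"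
    proof (rule bdd_aboveI2[of _ _ "C * 1"])
      fix u :: "'a \<Rightarrow> complex" assume "u \<in> {u. \<forall>x. norm (u x) \<le> indicator A x}"
      then have "norm (u x) \<le> indicator A x" for x by simp
      then have "norm (u x) \<le> 1" for x by (rule order_trans[OF _ indicator_le_1])
      then show "norm (\<Phi> u) \<le> C * 1" by (rule C(2))
    qed
  qed (use u in simp)
qed

lemma total_variation_least:
  assumes "\<And>u. (\<And>x. norm (u x) \<le> indicator A x) \<Longrightarrow> norm (\<Phi> u) \<le> c"
  shows "total_variation \<Phi> A \<le> c"
  unfolding total_variation_def
proof (rule cSUP_least)
  have "(\<lambda>x. 0) \<in> {u :: 'a \<Rightarrow> complex. \<forall>x. norm (u x) \<le> indicator A x}" by simp
  then show "{u :: 'a \<Rightarrow> complex. \<forall>x. norm (u x) \<le> indicator A x} \<noteq> {}"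
    by (simp only: ex_in_conv[symmetric]) (rule exI)
  fix u :: "'a \<Rightarrow> complex" assume "u \<in> {u. \<forall>x. norm (u x) \<le> indicator A x}"
  then show "norm (\<Phi> u) \<le> c" by (intro assms) simp
qed

lemma total_variation_nonneg: "\<Phi> \<in> linfty_dual \<Longrightarrow> total_variation \<Phi> A \<ge> 0"
  by (rule order_trans[OF norm_ge_zero total_variation_upper[of \<Phi> "\<lambda>x. 0"]]) simp_all

lemma total_variation_scale:
  assumes \<Phi>: "\<Phi> \<in> linfty_dual" and g: "\<And>x. norm (g x) \<le> M * indicator A x" and M: "M > 0"
  shows "norm (\<Phi> g) \<le> M * total_variation \<Phi> A"
proof -
  let ?u = "\<lambda>x. g x / of_real M"
  have u: "norm (?u x) \<le> indicator A x" for x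
    using g[of x] M by (simp add: norm_divide pos_divide_le_eq mult.commute)
  have "\<Phi> (\<lambda>x. of_real M * ?u x) = of_real M * \<Phi> ?u"
    by (rule linfty_dual_scale[OF \<Phi> indicator_dominated_linfty[OF u]])
  then have "norm (\<Phi> g) = M * norm (\<Phi> ?u)" using M by (simp add: norm_mult)
  also have "\<dots> \<le> M * total_variation \<Phi> A"
    using M by (intro mult_left_mono total_variation_upper[OF \<Phi> u]) simp
  finally show ?thesis .
qed

text \<open>A test function on the union splits into its restrictions, which gives one inequality.
  For the other, test functions on the two parts are rotated so that their values under
  \<open>\<Phi>\<close> add without cancellation; disjointness keeps the sum dominated by the
  indicator.\<close>

lemma total_variation_Un:
  assumes \<Phi>: "\<Phi> \<in> linfty_dual" and disj: "A \<inter> B = {}"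
  shows "total_variation \<Phi> (A \<union> B) = total_variation \<Phi> A + total_variation \<Phi> B"
proof (rule antisym)
  show "total_variation \<Phi> (A \<union> B) \<le> total_variation \<Phi> A + total_variation \<Phi> B"
  proof (rule total_variation_least)
    fix u :: "'a \<Rightarrow> complex" assume u: "\<And>x. norm (u x) \<le> indicator (A \<union> B) x"
    let ?a = "\<lambda>x. u x * indicator A x" and ?b = "\<lambda>x. u x * indicator B x"
    have a: "norm (?a x) \<le> indicator A x" and b: "norm (?b x) \<le> indicator B x" for x
      using u[of x] by (auto simp: indicator_def split: if_splits)
    have "(\<lambda>x. ?a x + ?b x) = u"
    proof
      fix x show "?a x + ?b x = u x"
        using u[of x] disj by (auto simp: indicator_def split: if_splits)
    qed
    then have eq: "\<Phi> u = \<Phi> ?a + \<Phi> ?b"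
      using linfty_dual_add[OF \<Phi> indicator_dominated_linfty[OF a] indicator_dominated_linfty[OF b]] by simp
    show "norm (\<Phi> u) \<le> total_variation \<Phi> A + total_variation \<Phi> B"
      unfolding eq using norm_triangle_ineq[of "\<Phi> ?a" "\<Phi> ?b"] total_variation_upper[OF \<Phi> a] total_variation_upper[OF \<Phi> b]
      by linarith
  qed
next
  have key: "norm (\<Phi> u) + norm (\<Phi> v) \<le> total_variation \<Phi> (A \<union> B)"
    if u: "\<And>x. norm (u x) \<le> indicator A x" and v: "\<And>x. norm (v x) \<le> indicator B x" for u v
  proof -
    note ul = indicator_dominated_linfty[OF u] and vl = indicator_dominated_linfty[OF v]
    \<comment> \<open>Scalars of modulus one, or zero if the value vanishes, that turn both values
      into nonnegative reals.\<close>
    let ?a = "cnj (sgn (\<Phi> u))" and ?b = "cnj (sgn (\<Phi> v))"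
    have rot: "cnj (sgn z) * z = of_real (norm z)" for z :: complex
    proof (cases "z = 0")
      case False
      then show ?thesis
        by (simp add: sgn_eq complex_norm_square[symmetric] power2_eq_square mult.commute
            flip: complex_norm_square)
    qed simp
    have "\<Phi> (\<lambda>x. ?a * u x + ?b * v x) = \<Phi> (\<lambda>x. ?a * u x) + \<Phi> (\<lambda>x. ?b * v x)"
      by (intro linfty_dual_add[OF \<Phi>] linfty_mult linfty_const ul vl)
    also have "\<dots> = of_real (norm (\<Phi> u) + norm (\<Phi> v))"
      using linfty_dual_scale[OF \<Phi> ul] linfty_dual_scale[OF \<Phi> vl] rot by simp
    finally have "norm (\<Phi> (\<lambda>x. ?a * u x + ?b * v x)) = norm (\<Phi> u) + norm (\<Phi> v)"
      by (metis norm_of_real abs_of_nonneg add_nonneg_nonneg norm_ge_zero)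
    moreover have "norm (\<Phi> (\<lambda>x. ?a * u x + ?b * v x)) \<le> total_variation \<Phi> (A \<union> B)"
    proof (rule total_variation_upper[OF \<Phi>])
      fix x
      have "norm (?a * u x + ?b * v x) \<le> norm (u x) + norm (v x)"
        by (rule order_trans[OF norm_triangle_ineq])
           (auto simp: norm_mult norm_sgn intro!: add_mono)
      also have "\<dots> \<le> indicator A x + indicator B x" by (intro add_mono u v)
      also have "\<dots> = indicator (A \<union> B) x" using disj by (auto simp: indicator_def)
      finally show "norm (?a * u x + ?b * v x) \<le> indicator (A \<union> B) x" .
    qed
    ultimately show ?thesis by simp
  qed
  \<comment> \<open>The two suprema are taken one at a time: over \<open>u\<close> for fixed
    \<open>v\<close>, then over \<open>v\<close>.\<close>
  have "total_variation \<Phi> A \<le> total_variation \<Phi> (A \<union> B) - norm (\<Phi> v)"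
    if v: "\<And>x. norm (v x) \<le> indicator B x" for v
  proof (rule total_variation_least)
    fix u :: "'a \<Rightarrow> complex" assume "\<And>x. norm (u x) \<le> indicator A x"
    from key[OF this v] show "norm (\<Phi> u) \<le> total_variation \<Phi> (A \<union> B) - norm (\<Phi> v)" by simp
  qed
  then have "total_variation \<Phi> B \<le> total_variation \<Phi> (A \<union> B) - total_variation \<Phi> A"
    by (intro total_variation_least) (simp add: algebra_simps)
  then show "total_variation \<Phi> A + total_variation \<Phi> B \<le> total_variation \<Phi> (A \<union> B)" by simp
qed

text \<open>Joint total boundedness of finitely many bounded functions, with net points in the
  domain. If no finite net existed, some ultrafilter would contain, for every \<open>z\<close>, the
  set of points far from \<open>z\<close>; but all functions converge along it, and a
  \<open>z\<close> close to the limits is contradictory.\<close>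

lemma finite_net:
  fixes G :: "('a \<Rightarrow> complex) set"
  assumes G: "finite G" "G \<subseteq> linfty" and e: "e > 0"
  shows "\<exists>E. finite E \<and> (\<forall>y. \<exists>z\<in>E. \<forall>g\<in>G. dist (g y) (g z) < e)"
proof (rule ccontr)
  assume neg: "\<not> ?thesis"
  define D where "D z = {y. \<exists>g\<in>G. dist (g y) (g z) \<ge> e}" for z
  have "\<exists>u\<in>ultrafilters. range D \<subseteq> u"
  proof (rule ultrafilter_extends_FIP)
    fix \<F> assume "finite \<F>" "\<F> \<subseteq> range D"
    then obtain E where E: "finite E" "\<F> = D ` E" using finite_subset_image by metis
    then obtain y where "\<And>z. z \<in> E \<Longrightarrow> \<exists>g\<in>G. \<not> dist (g y) (g z) < e" using neg by metis
    then have "y \<in> \<Inter>\<F>" using E by (auto simp: D_def not_less)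
    then show "\<Inter>\<F> \<noteq> {}" by auto
  qed
  then obtain u where u: "u \<in> ultrafilters" "\<And>z. D z \<in> u" by auto
  have "eventually (\<lambda>y. \<forall>g\<in>G. dist (g y) (ulim u g) < e / 2) (ufilter u)"
    by (rule eventually_ball_finite[OF G(1)])
       (use tendstoD[OF tendsto_ulim[OF u(1)], of _ "e / 2"] G(2) e in auto)
  then have mem: "{y. \<forall>g\<in>G. dist (g y) (ulim u g) < e / 2} \<in> u"
    by (simp add: eventually_ufilter[OF u(1)])
  then obtain z where z: "\<And>g. g \<in> G \<Longrightarrow> dist (g z) (ulim u g) < e / 2"
    using ultrafilters_empty[OF u(1)] by (metis (mono_tags, lifting) Collect_empty_eq)
  have "{y. \<forall>g\<in>G. dist (g y) (ulim u g) < e / 2} \<inter> D z = {}"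
  proof -
    have "dist (g y) (g z) < e" if "g \<in> G" "dist (g y) (ulim u g) < e / 2" for g y
      using dist_triangle_half_l[OF that(2) z[OF that(1)]] .
    then show ?thesis by (fastforce simp: D_def not_less[symmetric])
  qed
  then show False using ultrafilters_Int[OF u(1) mem u(2)[of z]] ultrafilters_empty[OF u(1)] by simp
qed

section \<open>Translates that converge at every ultrafilter\<close>

lemma free_ufilter_le_sequentially:
  assumes "V \<in> beta_remainder"
  shows "ufilter V \<le> sequentially"
proof (rule filter_leI)
  fix P :: "nat \<Rightarrow> bool" assume "eventually P sequentially"
  then have "finite {n. \<not> P n}" by (simp add: eventually_cofinite flip: cofinite_eq_sequentially)
  then have "{n. \<not> P n} \<notin> V" by (rule beta_remainder_finite[OF assms])
  then show "eventually P (ufilter V)"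
    using ultrafilters_Compl_iff[OF beta_remainder_ultrafilter[OF assms], of "{n. P n}"]
    by (simp add: eventually_ufilter beta_remainder_ultrafilter[OF assms] Collect_neg_eq)
qed

text \<open>Apply the condition to the images of \<open>V\<close> under the two sequences. No
  convergence of \<open>L\<close> is assumed, so its limit is taken along \<open>V\<close>.\<close>

lemma double_limit_sequences:
  fixes f :: "'a::group_add \<Rightarrow> complex"
  assumes f: "double_limit f" and V: "V \<in> beta_remainder"
    and L: "\<And>i. (\<lambda>k. f (x i + y k)) \<longlonglongrightarrow> L i"
    and h: "\<And>k. (\<lambda>i. f (x i + y k)) \<longlonglongrightarrow> h k" "h \<longlonglongrightarrow> H"
  shows "ulim V L = H"
proof -
  note V' = beta_remainder_ultrafilter[OF V]
  have fl: "f \<in> linfty" using f by (simp add: double_limit_def)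
  then obtain M where M: "\<And>z. norm (f z) \<le> M" by (auto simp: linfty_iff)
  have lim: "ulim V u = l" if "u \<longlonglongrightarrow> l" for u l
    by (rule ulim_eqI[OF V' tendsto_mono[OF free_ufilter_le_sequentially[OF V] that]])
  let ?r = "ultra_map x V" and ?s = "ultra_map y V"
  note rs = ultra_map_ultrafilter[OF V', of x] ultra_map_ultrafilter[OF V', of y]
  have "ulim (ultra_mult_R ?r ?s) f = ulim V (\<lambda>i. ulim ?s (\<lambda>z. f (x i + z)))"
    unfolding ulim_ultra_mult_R[OF rs fl]
    by (rule ulim_ultra_map[OF V']) (rule linfty_ulim[OF rs(2) M])
  also have "\<dots> = ulim V L"
    using lim[OF L] by (simp add: ulim_ultra_map[OF V' linfty_comp[OF fl]])
  finally have 1: "ulim (ultra_mult_R ?r ?s) f = ulim V L" .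
  have "ulim (ultra_mult_L ?r ?s) f = ulim V (\<lambda>k. ulim ?r (\<lambda>z. f (z + y k)))"
    unfolding ulim_ultra_mult_L[OF rs fl]
    by (rule ulim_ultra_map[OF V']) (rule linfty_ulim[OF rs(1) M])
  also have "\<dots> = ulim V h"
    using lim[OF h(1)] by (simp add: ulim_ultra_map[OF V' linfty_comp[OF fl]])
  also have "\<dots> = H" by (rule lim[OF h(2)])
  finally show ?thesis using 1 f rs by (simp add: double_limit_def)
qed

text \<open>The numerator two comes from the use below: two errors of size
  \<open>1 / real (Suc k)\<close> add up when a point is replaced by a nearby net point.\<close>

lemma tendsto_of_dist_less:
  fixes a :: "nat \<Rightarrow> complex"
  assumes "\<And>k. k \<ge> i \<Longrightarrow> dist (a k) l < 2 / real (Suc k)"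
  shows "a \<longlonglongrightarrow> l"
proof (rule LIMSEQ_I)
  fix r :: real assume r: "r > 0"
  obtain N :: nat where N: "2 / r < real N" using reals_Archimedean2 by blast
  have "norm (a n - l) < r" if "n \<ge> max i N" for n
  proof -
    have "dist (a n) l < 2 / real (Suc n)" using that by (intro assms) simp
    also have "\<dots> < r"
    proof -
      have "2 / r < real (Suc n)" using N that by simp
      then show ?thesis using r by (simp add: field_simps)
    qed
    finally show ?thesis by (simp add: dist_norm)
  qed
  then show "\<exists>no. \<forall>n\<ge>no. norm (a n - l) < r" by blast
qed

text \<open>
  The translates converge to \<open>h\<close> on ever finer finite nets \<open>E n\<close>, so that an ultrafilter
  at which they fail to converge would violate the double limit condition.
\<close>

lemma pointwise_convergent_translates:
  fixes f :: "'a::group_add \<Rightarrow> complex"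
  assumes f: "double_limit f" and p: "p \<in> ultrafilters" and S: "S \<in> p"
    and h_def: "h = (\<lambda>y. ulim p (\<lambda>x. f (x + y)))"
  shows "\<exists>g :: nat \<Rightarrow> 'a. range g \<subseteq> S \<and>
    (\<forall>q\<in>ultrafilters. \<forall>\<epsilon>>0. finite {n. {y. \<epsilon> \<le> norm (f (g n + y) - h y)} \<in> q})"
proof -
  have fl: "f \<in> linfty" using f by (simp add: double_limit_def)
  obtain M where M: "\<And>z. norm (f z) \<le> M" using fl by (auto simp: linfty_iff)
  have hl: "h \<in> linfty" unfolding h_def by (rule linfty_ulim[OF p M])
  define net where "net n T E \<longleftrightarrow>
      (\<forall>y. \<exists>z\<in>E. (\<forall>t\<in>T. dist (f (t + y)) (f (t + z)) < 1 / real (Suc n)) \<and> dist (h y) (h z) < 1 / real (Suc n))"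
    for n and T E :: "'a set"
  have net_exists: "\<exists>E. finite E \<and> net n T E" if T: "finite T" for n T
  proof -
    let ?G = "insert h ((\<lambda>t y. f (t + y)) ` T)"
    have "\<exists>E. finite E \<and> (\<forall>y. \<exists>z\<in>E. \<forall>g\<in>?G. dist (g y) (g z) < 1 / real (Suc n))"
      by (rule finite_net) (use T hl linfty_comp[OF fl] in auto)
    then show ?thesis unfolding net_def by (simp add: conj_commute)
  qed
  have net_mono: "net n T E" if "net n T E'" "E' \<subseteq> E" for n T E E'
    using that unfolding net_def by (meson subsetD)
  \<comment> \<open>The state holds the current translate \<open>g\<close>, a finite set
    \<open>T\<close> that accumulates the translates chosen so far, and a net \<open>E\<close> that
    is fine for \<open>T\<close> and for \<open>h\<close> together. By \<open>?Q\<close>, the next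
    translate is close to \<open>h\<close> on the present net.\<close>
  let ?P = "\<lambda>n (g, T, E). g \<in> S \<and> g \<in> T \<and> finite T \<and> finite E \<and> net n T E"
  let ?Q = "\<lambda>n (g, T, E) (g', T', E'). T \<subseteq> T' \<and> E \<subseteq> E' \<and> (\<forall>z\<in>E. dist (f (g' + z)) (h z) < 1 / real (Suc n))"
  have "\<exists>st. \<forall>n. ?P n (st n) \<and> ?Q n (st n) (st (Suc n))"
  proof (rule dependent_nat_choice)
    obtain g where "g \<in> S" using S ultrafilters_empty[OF p] by (cases "S = {}") auto
    moreover obtain E where "finite E" "net 0 {g} E" using net_exists[of "{g}" 0] by auto
    ultimately have "?P 0 (g, {g}, E)" by simp
    then show "\<exists>st. ?P 0 st" by (rule exI)
  next
    fix st :: "'a \<times> 'a set \<times> 'a set" and n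
    obtain g T E where st: "st = (g, T, E)" by (cases st)
    assume "?P n st"
    then have TE: "finite T" "finite E" by (simp_all add: st)
    have "eventually (\<lambda>x. \<forall>z\<in>E. dist (f (x + z)) (h z) < 1 / real (Suc n)) (ufilter p)"
    proof (rule eventually_ball_finite[OF TE(2)], rule ballI)
      fix z
      show "eventually (\<lambda>x. dist (f (x + z)) (h z) < 1 / real (Suc n)) (ufilter p)"
        unfolding h_def by (rule tendstoD[OF tendsto_ulim[OF p linfty_comp[OF fl]]]) simp
    qed
    moreover have "eventually (\<lambda>x. x \<in> S) (ufilter p)" using S by (simp add: eventually_ufilter[OF p])
    ultimately have "\<exists>x. (\<forall>z\<in>E. dist (f (x + z)) (h z) < 1 / real (Suc n)) \<and> x \<in> S"
      by (intro eventually_happens'[OF ufilter_nonbot[OF p]] eventually_conj)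
    then obtain g' where g': "g' \<in> S" "\<forall>z\<in>E. dist (f (g' + z)) (h z) < 1 / real (Suc n)" by auto
    obtain E' where E': "finite E'" "net (Suc n) (insert g' T) E'"
      using net_exists[of "insert g' T" "Suc n"] TE(1) by auto
    \<comment> \<open>The old net is kept, so that a point chosen from one net remains in all later
      ones.\<close>
    have "net (Suc n) (insert g' T) (E \<union> E')" by (rule net_mono[OF E'(2)]) simp
    then have "?P (Suc n) (g', insert g' T, E \<union> E') \<and> ?Q n st (g', insert g' T, E \<union> E')"
      using TE E'(1) g' by (auto simp: st)
    then show "\<exists>st'. ?P (Suc n) st' \<and> ?Q n st st'" by (rule exI)
  qed
  then obtain st where st': "\<forall>n. ?P n (st n) \<and> ?Q n (st n) (st (Suc n))" by (rule exE)
  note st = conjunct1[OF spec[OF st']] conjunct2[OF spec[OF st']]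
  define g T E where "g n = fst (st n)" and "T n = fst (snd (st n))" and "E n = snd (snd (st n))" for n
  have P: "g n \<in> S" "g n \<in> T n" "net n (T n) (E n)" for n
    using st(1)[of n] by (simp_all add: g_def T_def E_def split_beta)
  have Q: "T n \<subseteq> T (Suc n)" "E n \<subseteq> E (Suc n)" "\<And>z. z \<in> E n \<Longrightarrow> dist (f (g (Suc n) + z)) (h z) < 1 / real (Suc n)" for n
    using st(2)[of n] by (simp_all add: g_def T_def E_def split_beta)
  have T_mono: "T i \<subseteq> T n" and E_mono: "E i \<subseteq> E n" if "i \<le> n" for i n
    using that by (rule lift_Suc_mono_le[of T, OF Q(1)], rule lift_Suc_mono_le[of E, OF Q(2)])
  have "finite {n. {y. \<epsilon> \<le> norm (f (g n + y) - h y)} \<in> q}"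
    if q: "q \<in> ultrafilters" and \<epsilon>: "\<epsilon> > 0" for q \<epsilon>
  proof (rule ccontr)
    let ?N = "{n. {y. \<epsilon> \<le> norm (f (g n + y) - h y)} \<in> q}"
    assume "infinite ?N"
    \<comment> \<open>\<open>V\<close> concentrates on the indices at which the translates stay away
      from \<open>h\<close> along \<open>q\<close>.\<close>
    from free_ultrafilter_exists[OF this] obtain V where V: "V \<in> beta_remainder" "?N \<in> V"
      by (rule bexE)
    note V' = beta_remainder_ultrafilter[OF V(1)]
    define L where "L i = ulim q (\<lambda>y. f (g i + y))" for i
    define H where "H = ulim q h"
    \<comment> \<open>A point \<open>y\<close> nearly attaining the limits along \<open>q\<close> is
      replaced by a net point \<open>z\<close>; on net points the later translates are known to
      approach \<open>h\<close>.\<close>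
    have "\<exists>z\<in>E k. (\<forall>i\<le>k. dist (f (g i + z)) (L i) < 2 / real (Suc k)) \<and> dist (h z) H < 2 / real (Suc k)" for k
    proof -
      have "eventually (\<lambda>y. \<forall>i\<in>{..k}. dist (f (g i + y)) (L i) < 1 / real (Suc k)) (ufilter q)"
        unfolding L_def
        by (intro eventually_ball_finite ballI tendstoD[OF tendsto_ulim[OF q linfty_comp[OF fl]]]) simp_all
      moreover have "eventually (\<lambda>y. dist (h y) H < 1 / real (Suc k)) (ufilter q)"
        unfolding H_def by (rule tendstoD[OF tendsto_ulim[OF q hl]]) simp
      ultimately have "\<exists>y. (\<forall>i\<in>{..k}. dist (f (g i + y)) (L i) < 1 / real (Suc k)) \<and> dist (h y) H < 1 / real (Suc k)"
        by (intro eventually_happens'[OF ufilter_nonbot[OF q]] eventually_conj)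
      then obtain y where y: "\<And>i. i \<le> k \<Longrightarrow> dist (f (g i + y)) (L i) < 1 / real (Suc k)" "dist (h y) H < 1 / real (Suc k)"
        by auto
      from spec[OF P(3)[of k, unfolded net_def], of y] obtain z where z: "z \<in> E k"
        "\<And>t. t \<in> T k \<Longrightarrow> dist (f (t + y)) (f (t + z)) < 1 / real (Suc k)" "dist (h y) (h z) < 1 / real (Suc k)"
        by (elim bexE conjE) simp
      have comb: "dist c b < 2 / real (Suc k)"
        if "dist a b < 1 / real (Suc k)" "dist a c < 1 / real (Suc k)" for a b c :: complex
      proof -
        have "dist c b \<le> dist a c + dist a b" by (rule dist_triangle3)
        also have "\<dots> < 1 / real (Suc k) + 1 / real (Suc k)" using that by simp
        finally show ?thesis by simp
      qed
      have "dist (f (g i + z)) (L i) < 2 / real (Suc k)" if "i \<le> k" for i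
        by (rule comb[OF y(1)[OF that] z(2)]) (use P(2)[of i] T_mono[OF that] in auto)
      moreover have "dist (h z) H < 2 / real (Suc k)" by (rule comb[OF y(2) z(3)])
      ultimately show ?thesis using z(1) by (intro bexI[of _ z]) auto
    qed
    then have "\<forall>k. \<exists>z. z \<in> E k \<and> (\<forall>i\<le>k. dist (f (g i + z)) (L i) < 2 / real (Suc k)) \<and> dist (h z) H < 2 / real (Suc k)"
      by (simp add: Bex_def)
    from choice[OF this] obtain y where y: "\<And>k. y k \<in> E k"
      "\<And>i k. i \<le> k \<Longrightarrow> dist (f (g i + y k)) (L i) < 2 / real (Suc k)"
      "\<And>k. dist (h (y k)) H < 2 / real (Suc k)"
      by auto
    have LH: "ulim V L = H"
    proof (rule double_limit_sequences[OF f V(1), of g y L "\<lambda>k. h (y k)" H])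
      show "(\<lambda>k. f (g i + y k)) \<longlonglongrightarrow> L i" for i by (rule tendsto_of_dist_less[of i]) (rule y(2))
      show "(\<lambda>k. h (y k)) \<longlonglongrightarrow> H" by (rule tendsto_of_dist_less[of 0]) (rule y(3))
      show "(\<lambda>i. f (g i + y k)) \<longlonglongrightarrow> h (y k)" for k
      proof (rule tendsto_of_dist_less[of "Suc k"])
        \<comment> \<open>The translate of index \<open>Suc m\<close> is controlled on the net of
          index \<open>m\<close>, hence the shift by one; \<open>y k\<close> lies in that net as
          soon as \<open>k \<le> m\<close>.\<close>
        fix n assume "Suc k \<le> n"
        then obtain m where m: "n = Suc m" "k \<le> m" by (cases n) auto
        have "dist (f (g (Suc m) + y k)) (h (y k)) < 1 / real (Suc m)"
          by (rule Q(3)) (use E_mono[OF m(2)] y(1) in auto)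
        also have "\<dots> \<le> 2 / real (Suc (Suc m))" by (simp add: field_simps)
        finally show "dist (f (g n + y k)) (h (y k)) < 2 / real (Suc n)" by (simp add: m(1))
      qed
    qed
    \<comment> \<open>The distance survives the limit along \<open>q\<close> and then the limit
      along \<open>V\<close>, against \<open>LH\<close>.\<close>
    have "norm (L i - H) \<ge> \<epsilon>" if "i \<in> ?N" for i
    proof (rule tendsto_lowerbound[OF _ _ ufilter_nonbot[OF q]])
      show "((\<lambda>y. norm (f (g i + y) - h y)) \<longlongrightarrow> norm (L i - H)) (ufilter q)"
        unfolding L_def H_def by (intro tendsto_norm tendsto_diff tendsto_ulim q hl linfty_comp[OF fl])
      show "eventually (\<lambda>y. \<epsilon> \<le> norm (f (g i + y) - h y)) (ufilter q)"
        using that by (simp add: eventually_ufilter[OF q])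
    qed
    then have far: "eventually (\<lambda>i. \<epsilon> \<le> norm (L i - H)) (ufilter V)"
      unfolding eventually_ufilter[OF V'] by (intro ultrafilters_mono[OF V' V(2)]) auto
    have "((\<lambda>i. norm (L i - H)) \<longlongrightarrow> norm (ulim V L - H)) (ufilter V)"
    proof (intro tendsto_norm tendsto_diff tendsto_const tendsto_ulim[OF V'])
      have "norm (L i) \<le> M" for i
        unfolding L_def using ulim_norm_le[OF q linfty_comp[OF fl], of _ 0 M] M by simp
      then show "L \<in> linfty" by (auto simp: linfty_iff)
    qed
    from tendsto_lowerbound[OF this far ufilter_nonbot[OF V']] show False using \<epsilon> LH by simp
  qed
  moreover have "range g \<subseteq> S" using P(1) by auto
  ultimately show ?thesis by blast
qed

text \<open>If convergence failed, the sequence of translates could be drawn from the set where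
  \<open>\<Phi>\<close> is off by at least \<open>c\<close>. Its deviation sets then have variation
  bounded below, so infinitely many of them lie in one ultrafilter, where the sequence converges: a
  contradiction.\<close>

lemma double_limit_functional:
  fixes f :: "'a::group_add \<Rightarrow> complex"
  assumes f: "double_limit f" and \<Phi>: "\<Phi> \<in> linfty_dual" and p: "p \<in> ultrafilters"
  shows "((\<lambda>\<gamma>. \<Phi> (\<lambda>x. f (\<gamma> + x))) \<longlongrightarrow> \<Phi> (\<lambda>y. ulim p (\<lambda>x. f (x + y)))) (ufilter p)"
proof (rule tendstoI, rule ccontr)
  define h where "h = (\<lambda>y. ulim p (\<lambda>x. f (x + y)))"
  fix c :: real assume c: "c > 0"
    and "\<not> eventually (\<lambda>\<gamma>. dist (\<Phi> (\<lambda>x. f (\<gamma> + x))) (\<Phi> (\<lambda>y. ulim p (\<lambda>x. f (x + y)))) < c) (ufilter p)"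
  then have "{\<gamma>. \<not> dist (\<Phi> (\<lambda>x. f (\<gamma> + x))) (\<Phi> h) < c} \<in> p"
    unfolding Collect_neg_eq ultrafilters_Compl_iff[OF p] by (simp add: eventually_ufilter[OF p] h_def)
  from pointwise_convergent_translates[OF f p this h_def] obtain g :: "nat \<Rightarrow> 'a"
    where g: "range g \<subseteq> {\<gamma>. \<not> dist (\<Phi> (\<lambda>x. f (\<gamma> + x))) (\<Phi> h) < c}"
      and fin: "\<forall>q\<in>ultrafilters. \<forall>\<epsilon>>0. finite {n. {y. \<epsilon> \<le> norm (f (g n + y) - h y)} \<in> q}"
    by (elim exE conjE)
  have fl: "f \<in> linfty" using f by (simp add: double_limit_def)
  then obtain M where M: "\<And>z. norm (f z) \<le> M" "M > 0"
    unfolding linfty_iff by (metis gt_ex norm_ge_zero order_trans less_imp_le order.strict_trans1)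
  have hM: "norm (h y) \<le> M" for y
    unfolding h_def using ulim_norm_le[OF p linfty_comp[OF fl], of _ 0 M] M(1) by simp
  let ?\<mu> = "total_variation \<Phi>"
  \<comment> \<open>Deviations below \<open>\<epsilon>\<close> then contribute at most
    \<open>c / 2\<close> to \<open>\<Phi>\<close>; adding one avoids division by zero.\<close>
  define \<epsilon> where "\<epsilon> = c / (2 * (?\<mu> UNIV + 1))"
  note \<mu>_nonneg = total_variation_nonneg[OF \<Phi>]
  have \<epsilon>: "\<epsilon> > 0" "\<epsilon> * ?\<mu> UNIV \<le> c / 2"
    using c \<mu>_nonneg[of UNIV] by (simp_all add: \<epsilon>_def field_simps)
  define E where "E n = {y. \<epsilon> \<le> norm (f (g n + y) - h y)}" for n
  \<comment> \<open>The deviation is at most \<open>2 * M\<close> everywhere, and \<open>E n\<close>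
    must account for the remaining \<open>c / 2\<close>.\<close>
  have large: "c / (4 * M) \<le> ?\<mu> (E n)" for n
  proof -
    let ?d = "\<lambda>y. f (g n + y) - h y"
    have d: "norm (?d y) \<le> 2 * M" for y
      using norm_triangle_ineq4[of "f (g n + y)" "h y"] M(1)[of "g n + y"] hM[of y] by linarith
    let ?a = "\<lambda>y. ?d y * indicator (E n) y" and ?b = "\<lambda>y. ?d y * indicator (- E n) y"
    have a: "norm (?a y) \<le> 2 * M * indicator (E n) y" and b: "norm (?b y) \<le> \<epsilon> * indicator UNIV y" for y
      using d[of y] \<epsilon>(1) by (auto simp: indicator_def E_def)
    have dl: "?d \<in> linfty" using d by (auto simp: linfty_iff)
    have hl: "h \<in> linfty" using hM by (auto simp: linfty_iff)
    have "?d = (\<lambda>y. ?a y + ?b y)" by (auto simp: indicator_def)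
    then have "\<Phi> ?d = \<Phi> (\<lambda>y. ?a y + ?b y)" by simp
    also have "\<dots> = \<Phi> ?a + \<Phi> ?b"
      by (intro linfty_dual_add[OF \<Phi>] linfty_mult[OF dl linfty_indicator])
    finally have eq: "\<Phi> (\<lambda>x. f (g n + x)) - \<Phi> h = \<Phi> ?a + \<Phi> ?b"
      unfolding linfty_dual_diff[OF \<Phi> linfty_comp[OF fl] hl] .
    have "g n \<in> {\<gamma>. \<not> dist (\<Phi> (\<lambda>x. f (\<gamma> + x))) (\<Phi> h) < c}" by (rule subsetD[OF g rangeI])
    then have "c \<le> norm (\<Phi> ?a + \<Phi> ?b)" unfolding eq[symmetric] by (simp add: dist_norm)
    also have "\<dots> \<le> norm (\<Phi> ?a) + norm (\<Phi> ?b)" by (rule norm_triangle_ineq)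
    also have "\<dots> \<le> 2 * M * ?\<mu> (E n) + \<epsilon> * ?\<mu> UNIV"
      by (intro add_mono total_variation_scale[OF \<Phi>] a b) (use M \<epsilon> in auto)
    finally have "c / 2 \<le> 2 * M * ?\<mu> (E n)" using \<epsilon>(2) by linarith
    then show ?thesis using M(2) by (simp add: field_simps)
  qed
  have "\<exists>q\<in>ultrafilters. infinite {n. E n \<in> q}"
    by (rule additive_infinitely_often[of ?\<mu>, OF \<mu>_nonneg total_variation_Un[OF \<Phi>] _ large]) (use c M in auto)
  then obtain q where q: "q \<in> ultrafilters" and inf: "infinite {n. E n \<in> q}" by (rule bexE)
  have "finite {n. E n \<in> q}" unfolding E_def using fin q \<epsilon>(1) by simp
  then show False using inf by simp
qed

text \<open>The orbit lies in the image of the compact space of ultrafilters under the weakly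
  continuous map \<open>h\<close>. That image is compact, hence closed, so it contains the closure
  of the orbit.\<close>

lemma double_limit_imp_WAP:
  fixes f :: "'a::group_add \<Rightarrow> complex"
  assumes f: "double_limit f"
  shows "f \<in> WAP"
proof -
  have fl: "f \<in> linfty" using f by (simp add: double_limit_def)
  obtain M where M: "\<And>z. norm (f z) \<le> M" using fl by (auto simp: linfty_iff)
  define h where "h p = (\<lambda>y. ulim p (\<lambda>x. f (x + y)))" for p
  have cont: "continuous_map beta_topology linfty_weak_topology h"
  proof (rule continuous_map_linfty_weak)
    show "h p \<in> linfty" if "p \<in> topspace beta_topology" for p
      unfolding h_def by (rule linfty_ulim[OF _ M]) (use that in \<open>simp add: topspace_beta\<close>)
  next
    fix \<Phi> :: "('a \<Rightarrow> complex) \<Rightarrow> complex" assume \<Phi>: "\<Phi> \<in> linfty_dual"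
    obtain C where C: "\<And>f M. (\<And>x. norm (f x) \<le> M) \<Longrightarrow> norm (\<Phi> f) \<le> C * M"
      using linfty_dual_bound[OF \<Phi>] by blast
    \<comment> \<open>The values of \<open>\<Phi>\<close> on translates form a bounded function of
      \<open>\<gamma>\<close>; its continuous extension is the map sending \<open>p\<close> to
      \<open>\<Phi> (h p)\<close>.\<close>
    have "norm (\<Phi> (\<lambda>x. f (\<gamma> + x))) \<le> C * M" for \<gamma> by (rule C) (rule M)
    then have "(\<lambda>\<gamma>. \<Phi> (\<lambda>x. f (\<gamma> + x))) \<in> linfty" by (auto simp: linfty_iff)
    from continuous_map_ulim[OF this]
    show "continuous_map beta_topology euclidean (\<lambda>p. \<Phi> (h p))"
    proof (rule continuous_map_eq)
      fix p :: "'a set set" assume "p \<in> topspace beta_topology"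
      then have p: "p \<in> ultrafilters" by (simp add: topspace_beta)
      show "ulim p (\<lambda>\<gamma>. \<Phi> (\<lambda>x. f (\<gamma> + x))) = \<Phi> (h p)"
        unfolding h_def by (rule ulim_eqI[OF p double_limit_functional[OF f \<Phi> p]])
    qed
  qed
  have K: "compactin linfty_weak_topology (h ` ultrafilters)"
    by (rule image_compactin[OF _ cont]) (use compact_space_beta in \<open>simp add: compact_space_def topspace_beta\<close>)
  have "orbit f \<subseteq> h ` ultrafilters"
  proof
    fix u assume "u \<in> orbit f"
    then obtain \<gamma> where "u = (\<lambda>x. f (\<gamma> + x))" by (auto simp: orbit_def)
    then have "u = h (principal \<gamma>)" by (simp add: h_def ulim_principal)
    then show "u \<in> h ` ultrafilters" by (rule image_eqI[OF _ principal_ultrafilter])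
  qed
  then have "linfty_weak_topology closure_of orbit f \<subseteq> h ` ultrafilters"
    by (rule closure_of_minimal) (rule compactin_imp_closedin[OF Hausdorff_linfty_weak K])
  then show ?thesis unfolding WAP_def using fl closed_compactin[OF K] by simp
qed

lemma WAP_iff_double_limit: "f \<in> WAP \<longleftrightarrow> double_limit f"
  using WAP_imp_double_limit double_limit_imp_WAP by blast

section \<open>The algebra of weakly almost periodic functions\<close>

lemma WAP_linfty: "f \<in> WAP \<Longrightarrow> f \<in> linfty"
  by (simp add: WAP_def)

lemma WAP_ulim_eq:
  "f \<in> WAP \<Longrightarrow> p \<in> ultrafilters \<Longrightarrow> q \<in> ultrafilters \<Longrightarrow> ulim (ultra_mult_R p q) f = ulim (ultra_mult_L p q) f"
  by (simp add: WAP_iff_double_limit double_limit_def)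

lemma WAP_I:
  assumes "f \<in> linfty"
    and "\<And>p q. p \<in> ultrafilters \<Longrightarrow> q \<in> ultrafilters \<Longrightarrow> ulim (ultra_mult_R p q) f = ulim (ultra_mult_L p q) f"
  shows "f \<in> WAP"
  using assms by (simp add: WAP_iff_double_limit double_limit_def)

lemma WAP_const: "(\<lambda>x. c) \<in> WAP"
  by (rule WAP_I) (simp_all add: linfty_const ulim_const ultra_mult_R_ultrafilter ultra_mult_L_ultrafilter)

text \<open>Via the criterion, closure under an operation reduces to its compatibility with limits
  along ultrafilters, here and for products, conjugates and inverses.\<close>

lemma WAP_add: "f \<in> WAP \<Longrightarrow> g \<in> WAP \<Longrightarrow> (\<lambda>x. f x + g x) \<in> WAP"
  by (rule WAP_I)
     (simp_all add: linfty_add WAP_linfty ulim_add ultra_mult_R_ultrafilter ultra_mult_L_ultrafilter WAP_ulim_eq)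

lemma WAP_mult: "f \<in> WAP \<Longrightarrow> g \<in> WAP \<Longrightarrow> (\<lambda>x. f x * g x) \<in> WAP"
  by (rule WAP_I)
     (simp_all add: linfty_mult WAP_linfty ulim_mult ultra_mult_R_ultrafilter ultra_mult_L_ultrafilter WAP_ulim_eq)

lemma ulim_cnj: "p \<in> ultrafilters \<Longrightarrow> f \<in> linfty \<Longrightarrow> ulim p (\<lambda>x. cnj (f x)) = cnj (ulim p f)"
  by (intro ulim_eqI tendsto_cnj tendsto_ulim)

lemma WAP_cnj:
  assumes "f \<in> WAP"
  shows "(\<lambda>x. cnj (f x)) \<in> WAP"
proof (rule WAP_I)
  show "(\<lambda>x. cnj (f x)) \<in> linfty" using WAP_linfty[OF assms] by (simp add: linfty_iff)
qed (simp add: ulim_cnj WAP_linfty[OF assms] ultra_mult_R_ultrafilter ultra_mult_L_ultrafilter WAP_ulim_eq[OF assms])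

lemma ulim_inverse:
  assumes p: "p \<in> ultrafilters" and f: "f \<in> linfty" and e: "e > 0" "\<And>x. norm (f x) \<ge> e"
  shows "ulim p (\<lambda>x. inverse (f x)) = inverse (ulim p f)"
proof (intro ulim_eqI p tendsto_inverse tendsto_ulim f)
  have "e \<le> norm (ulim p f)"
    by (rule tendsto_lowerbound[OF tendsto_norm[OF tendsto_ulim[OF p f]] _ ufilter_nonbot[OF p]])
       (use e in simp)
  then show "ulim p f \<noteq> 0" using e(1) by auto
qed

text \<open>Needed for surjectivity of the canonical map: an element of the kernel of a character
  cannot be bounded away from zero.\<close>

lemma WAP_inverse:
  assumes f: "f \<in> WAP" and e: "e > 0" "\<And>x. norm (f x) \<ge> e"
  shows "(\<lambda>x. inverse (f x)) \<in> WAP"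
proof (rule WAP_I)
  have "norm (inverse (f x)) \<le> inverse e" for x
    using e(1) e(2)[of x] by (simp add: norm_inverse le_imp_inverse_le)
  then show "(\<lambda>x. inverse (f x)) \<in> linfty" by (auto simp: linfty_iff)
qed (simp add: ulim_inverse[OF _ WAP_linfty[OF f] e] ultra_mult_R_ultrafilter ultra_mult_L_ultrafilter WAP_ulim_eq[OF f])

text \<open>By associativity a left translation of \<open>f\<close> is absorbed into the left factor
  \<open>p\<close>, which becomes an image ultrafilter.\<close>

lemma WAP_translate_left:
  assumes f: "f \<in> WAP"
  shows "(\<lambda>x. f (a + x)) \<in> WAP"
proof (rule WAP_I)
  note fl = WAP_linfty[OF f]
  obtain M where M: "\<And>x. norm (f x) \<le> M" using fl by (auto simp: linfty_iff)
  show al: "(\<lambda>x. f (a + x)) \<in> linfty" by (rule linfty_comp[OF fl])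
  fix p q :: "'a set set" assume p: "p \<in> ultrafilters" and q: "q \<in> ultrafilters"
  let ?p = "ultra_map (\<lambda>x. a + x) p"
  note p' = ultra_map_ultrafilter[OF p, of "\<lambda>x. a + x"]
  have "ulim (ultra_mult_R p q) (\<lambda>x. f (a + x)) = ulim p (\<lambda>x. ulim q (\<lambda>y. f ((a + x) + y)))"
    by (simp add: ulim_ultra_mult_R[OF p q al] add.assoc)
  also have "\<dots> = ulim (ultra_mult_R ?p q) f"
    by (simp add: ulim_ultra_mult_R[OF p' q fl] ulim_ultra_map[OF p linfty_ulim[OF q M]])
  also have "\<dots> = ulim (ultra_mult_L ?p q) f" by (rule WAP_ulim_eq[OF f p' q])
  also have "\<dots> = ulim q (\<lambda>y. ulim p (\<lambda>x. f (a + x + y)))"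
    by (simp add: ulim_ultra_mult_L[OF p' q fl] ulim_ultra_map[OF p linfty_comp[OF fl]])
  also have "\<dots> = ulim (ultra_mult_L p q) (\<lambda>x. f (a + x))"
    by (simp add: ulim_ultra_mult_L[OF p q al] add.assoc)
  finally show "ulim (ultra_mult_R p q) (\<lambda>x. f (a + x)) = ulim (ultra_mult_L p q) (\<lambda>x. f (a + x))" .
qed

text \<open>Not visible from the left orbit, but the criterion is symmetric: the translation is
  absorbed into the right factor.\<close>

lemma WAP_translate_right:
  assumes f: "f \<in> WAP"
  shows "(\<lambda>x. f (x + a)) \<in> WAP"
proof (rule WAP_I)
  note fl = WAP_linfty[OF f]
  obtain M where M: "\<And>x. norm (f x) \<le> M" using fl by (auto simp: linfty_iff)
  show al: "(\<lambda>x. f (x + a)) \<in> linfty" by (rule linfty_comp[OF fl])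
  fix p q :: "'a set set" assume p: "p \<in> ultrafilters" and q: "q \<in> ultrafilters"
  let ?q = "ultra_map (\<lambda>x. x + a) q"
  note q' = ultra_map_ultrafilter[OF q, of "\<lambda>x. x + a"]
  have "ulim (ultra_mult_R p q) (\<lambda>x. f (x + a)) = ulim p (\<lambda>x. ulim q (\<lambda>y. f (x + (y + a))))"
    by (simp add: ulim_ultra_mult_R[OF p q al] add.assoc)
  also have "\<dots> = ulim (ultra_mult_R p ?q) f"
    by (simp add: ulim_ultra_mult_R[OF p q' fl] ulim_ultra_map[OF q linfty_comp[OF fl]])
  also have "\<dots> = ulim (ultra_mult_L p ?q) f" by (rule WAP_ulim_eq[OF f p q'])
  also have "\<dots> = ulim q (\<lambda>y. ulim p (\<lambda>x. f (x + (y + a))))"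
    by (simp add: ulim_ultra_mult_L[OF p q' fl] ulim_ultra_map[OF q linfty_ulim[OF p M]])
  also have "\<dots> = ulim (ultra_mult_L p q) (\<lambda>x. f (x + a))"
    by (simp add: ulim_ultra_mult_L[OF p q al] add.assoc)
  finally show "ulim (ultra_mult_R p q) (\<lambda>x. f (x + a)) = ulim (ultra_mult_L p q) (\<lambda>x. f (x + a))" .
qed

section \<open>Functions supported away from the products\<close>

lemma ulim_eq_0:
  assumes p: "p \<in> ultrafilters" and A: "A \<notin> p" "\<And>x. x \<notin> A \<Longrightarrow> f x = 0"
  shows "ulim p f = 0"
proof -
  have "- A \<in> p" using ultrafilters_Compl_iff[OF p] A(1) by simp
  then have "eventually (\<lambda>x. 0 = f x) (ufilter p)"
    unfolding eventually_ufilter[OF p] by (rule ultrafilters_mono[OF p]) (use A(2) in auto)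
  then have "ulim p f = ulim p (\<lambda>x. 0)" by (rule ulim_cong[OF p linfty_const])
  then show ?thesis by (simp add: ulim_const[OF p])
qed

text \<open>With a principal factor one of the two limits is an evaluation, and there is nothing to
  interchange.\<close>

lemma ultra_mult_principal_left: "ultra_mult_R (principal x) q = ultra_mult_L (principal x) q"
  by (auto simp: mem_ultra_mult_R mem_ultra_mult_L) (simp_all add: principal_def)

lemma ultra_mult_principal_right: "ultra_mult_R p (principal y) = ultra_mult_L p (principal y)"
  by (auto simp: mem_ultra_mult_R mem_ultra_mult_L) (simp_all add: principal_def)

lemma WAP_supported:
  assumes f: "f \<in> linfty" "\<And>x. x \<notin> A \<Longrightarrow> f x = 0"
    and A: "\<And>p q. p \<in> beta_remainder \<Longrightarrow> q \<in> beta_remainder \<Longrightarrow> A \<notin> ultra_mult_R p q \<and> A \<notin> ultra_mult_L p q"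
  shows "f \<in> WAP"
proof (rule WAP_I[OF f(1)])
  fix p q :: "'a set set" assume p: "p \<in> ultrafilters" and q: "q \<in> ultrafilters"
  show "ulim (ultra_mult_R p q) f = ulim (ultra_mult_L p q) f"
  proof (cases "p \<in> beta_remainder \<and> q \<in> beta_remainder")
    case True
    then show ?thesis
      using A ulim_eq_0[OF ultra_mult_R_ultrafilter[OF p q] _ f(2), of A]
        ulim_eq_0[OF ultra_mult_L_ultrafilter[OF p q] _ f(2), of A] by simp
  next
    case False
    then consider x where "p = principal x" | x where "q = principal x"
      using p q by (auto simp: beta_remainder_def)
    then show ?thesis by cases (simp_all add: ultra_mult_principal_left ultra_mult_principal_right)
  qed
qed

text \<open>These functions keep the group points apart from the remainder in the quotient.\<close>

lemma WAP_indicator_singleton: "indicator {x :: 'a::group_add} \<in> WAP"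
proof (rule WAP_supported[OF linfty_indicator, of "{x}"])
  fix p q :: "'a set set" assume pq: "p \<in> beta_remainder" "q \<in> beta_remainder"
  show "{x} \<notin> ultra_mult_R p q \<and> {x} \<notin> ultra_mult_L p q"
    using ultra_mult_R_remainder[OF pq] ultra_mult_L_remainder[OF pq] by (simp add: beta_remainder_iff)
qed simp

section \<open>The compactification as a quotient of the space of ultrafilters\<close>

lemma openin_wap: "f \<in> WAP \<Longrightarrow> open U \<Longrightarrow> openin wap_topology {\<phi> \<in> wap_space. \<phi> f \<in> U}"
  unfolding wap_topology_def by (rule topology_generated_by_Basis) auto

lemma topspace_wap: "topspace wap_topology = wap_space"
proof
  show "topspace wap_topology \<subseteq> wap_space"
    unfolding wap_topology_def topology_generated_by_topspace by auto
  have "openin wap_topology {\<phi> \<in> wap_space. \<phi> (\<lambda>x. 0) \<in> UNIV}"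
    by (rule openin_wap[OF WAP_const]) simp
  from openin_subset[OF this] show "wap_space \<subseteq> topspace wap_topology" by simp
qed

lemma continuous_map_wap:
  fixes g :: "'b \<Rightarrow> (('a::group_add \<Rightarrow> complex) \<Rightarrow> complex)"
  assumes "\<And>x. x \<in> topspace X \<Longrightarrow> g x \<in> wap_space"
    and "\<And>f. f \<in> WAP \<Longrightarrow> continuous_map X euclidean (\<lambda>x. g x f)"
  shows "continuous_map X wap_topology g"
  unfolding wap_topology_def
proof (rule continuous_on_generated_topo)
  fix U :: "(('a \<Rightarrow> complex) \<Rightarrow> complex) set"
  assume "U \<in> {{\<phi> \<in> wap_space. \<phi> f \<in> U} | f U. f \<in> WAP \<and> open U}"
  then obtain f V where U: "U = {\<phi> \<in> wap_space. \<phi> f \<in> V}" "f \<in> WAP" "open V" by auto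
  have "openin X {x \<in> topspace X. g x f \<in> V}"
    using openin_continuous_map_preimage[OF assms(2)[OF U(2)]] U(3) by simp
  moreover have "g -` U \<inter> topspace X = {x \<in> topspace X. g x f \<in> V}" using U(1) assms(1) by auto
  ultimately show "openin X (g -` U \<inter> topspace X)" by simp
next
  have "g ` topspace X \<subseteq> topspace wap_topology"
    using assms(1) by (auto simp: topspace_wap)
  then show "g ` topspace X \<subseteq> \<Union>{{\<phi> \<in> wap_space. \<phi> f \<in> U} | f U. f \<in> WAP \<and> open U}"
    by (simp only: wap_topology_def topology_generated_by_topspace)
qed

lemma wap_space_eqI:
  assumes "\<phi> \<in> wap_space" "\<psi> \<in> wap_space" "\<And>f. f \<in> WAP \<Longrightarrow> \<phi> f = \<psi> f"
  shows "\<phi> = \<psi>"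
proof (rule extensionalityI)
  show "\<phi> \<in> extensional WAP" "\<psi> \<in> extensional WAP" using assms(1,2) by (simp_all add: wap_space_def)
qed (rule assms(3))

lemma Hausdorff_wap: "Hausdorff_space wap_topology"
  unfolding Hausdorff_space_def topspace_wap
proof (intro allI impI)
  fix \<phi> \<psi> :: "('a \<Rightarrow> complex) \<Rightarrow> complex"
  assume ne: "\<phi> \<in> wap_space \<and> \<psi> \<in> wap_space \<and> \<phi> \<noteq> \<psi>"
  then obtain f where f: "f \<in> WAP" "\<phi> f \<noteq> \<psi> f" using wap_space_eqI by metis
  from f(2) obtain U V where UV: "open U" "open V" "\<phi> f \<in> U" "\<psi> f \<in> V" "U \<inter> V = {}"
    by (rule separation_t2[THEN iffD1, THEN exE]) auto
  let ?O = "\<lambda>U. {\<phi> \<in> wap_space. \<phi> f \<in> U}"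
  have "openin wap_topology (?O U)" "openin wap_topology (?O V)"
    using UV f(1) by (simp_all add: openin_wap)
  moreover have "\<phi> \<in> ?O U" "\<psi> \<in> ?O V" "disjnt (?O U) (?O V)"
    using ne UV by (auto simp: disjnt_def)
  ultimately show "\<exists>U V. openin wap_topology U \<and> openin wap_topology V \<and>
      \<phi> \<in> U \<and> \<psi> \<in> V \<and> disjnt U V" by meson
qed

text \<open>The canonical map in explicit form; its restriction to \<open>ultrafilters\<close> is
  shown below to satisfy the defining description.\<close>

definition wap_lim :: "'a::group_add set set \<Rightarrow> (('a \<Rightarrow> complex) \<Rightarrow> complex)" where
  "wap_lim p = restrict (ulim p) WAP"

lemma wap_lim_apply: "f \<in> WAP \<Longrightarrow> wap_lim p f = ulim p f"
  by (simp add: wap_lim_def)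

lemma wap_lim_principal: "wap_lim (principal x) = wap_point x"
  by (simp add: wap_lim_def wap_point_def ulim_principal restrict_def fun_eq_iff)

lemma wap_lim_in_space:
  assumes p: "p \<in> ultrafilters"
  shows "wap_lim p \<in> wap_space"
  unfolding wap_space_def
proof (intro CollectI conjI ballI allI)
  show "wap_lim p \<in> extensional WAP" by (simp add: wap_lim_def)
  show "wap_lim p (\<lambda>x. f x + g x) = wap_lim p f + wap_lim p g" if "f \<in> WAP" "g \<in> WAP" for f g
    using that by (simp add: wap_lim_apply WAP_add ulim_add[OF p] WAP_linfty)
  show "wap_lim p (\<lambda>x. f x * g x) = wap_lim p f * wap_lim p g" if "f \<in> WAP" "g \<in> WAP" for f g
    using that by (simp add: wap_lim_apply WAP_mult ulim_mult[OF p] WAP_linfty)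
  show "wap_lim p (\<lambda>x. c * f x) = c * wap_lim p f" if "f \<in> WAP" for f c
    using that ulim_mult[OF p linfty_const] ulim_const[OF p]
    by (simp add: wap_lim_apply WAP_mult WAP_const WAP_linfty)
  show "\<exists>f\<in>WAP. wap_lim p f \<noteq> 0"
    by (rule bexI[OF _ WAP_const[of 1]]) (simp add: wap_lim_apply WAP_const ulim_const[OF p])
qed

lemma wap_lim_eqI:
  assumes "p \<in> ultrafilters" "q \<in> ultrafilters" "\<And>f. f \<in> WAP \<Longrightarrow> ulim p f = ulim q f"
  shows "wap_lim p = wap_lim q"
  by (rule wap_space_eqI[OF wap_lim_in_space wap_lim_in_space]) (use assms in \<open>simp_all add: wap_lim_apply\<close>)

lemma wap_lim_eqD: "wap_lim p = wap_lim q \<Longrightarrow> f \<in> WAP \<Longrightarrow> ulim p f = ulim q f"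
  by (metis wap_lim_apply)

lemma continuous_map_wap_lim: "continuous_map beta_topology wap_topology wap_lim"
proof (rule continuous_map_wap)
  show "wap_lim p \<in> wap_space" if "p \<in> topspace beta_topology" for p :: "'a set set"
    using that by (simp add: topspace_beta wap_lim_in_space)
  show "continuous_map beta_topology euclidean (\<lambda>p. wap_lim p f)" if "f \<in> WAP" for f :: "'a \<Rightarrow> complex"
    using continuous_map_ulim[OF WAP_linfty[OF that]] by (simp add: wap_lim_apply[OF that])
qed

lemma wap_space_add: "\<phi> \<in> wap_space \<Longrightarrow> f \<in> WAP \<Longrightarrow> g \<in> WAP \<Longrightarrow> \<phi> (\<lambda>x. f x + g x) = \<phi> f + \<phi> g"
  and wap_space_mult: "\<phi> \<in> wap_space \<Longrightarrow> f \<in> WAP \<Longrightarrow> g \<in> WAP \<Longrightarrow> \<phi> (\<lambda>x. f x * g x) = \<phi> f * \<phi> g"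
  and wap_space_scale: "\<phi> \<in> wap_space \<Longrightarrow> f \<in> WAP \<Longrightarrow> \<phi> (\<lambda>x. c * f x) = c * \<phi> f"
  by (simp_all add: wap_space_def)

lemma wap_space_const:
  assumes \<phi>: "\<phi> \<in> wap_space"
  shows "\<phi> (\<lambda>x. c) = c"
proof -
  from \<phi> obtain f where f: "f \<in> WAP" "\<phi> f \<noteq> 0" by (auto simp: wap_space_def)
  have "\<phi> f * \<phi> (\<lambda>x. 1) = \<phi> f" using wap_space_mult[OF \<phi> f(1) WAP_const[of 1]] by simp
  then have "\<phi> (\<lambda>x. 1) = 1" using f(2) by simp
  then show ?thesis using wap_space_scale[OF \<phi> WAP_const[of 1], of c] by simp
qed

text \<open>
  The sets on which finitely many functions are close to their prescribed values all contain one
  of the form \<open>{x. h x < e}\<close> with a single nonnegative \<open>h\<close> in the kernel of the character; such a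
  set is nonempty since otherwise \<open>h\<close> would be invertible.
\<close>

lemma wap_lim_surj: "wap_lim ` ultrafilters = wap_space"
proof (intro equalityI subsetI)
  fix \<phi> :: "('a \<Rightarrow> complex) \<Rightarrow> complex" assume \<phi>: "\<phi> \<in> wap_space"
  \<comment> \<open>The equation with \<open>norm\<close> says that \<open>h\<close> takes
    nonnegative real values, so that norms of sums add.\<close>
  define N where "N = {h \<in> WAP. \<phi> h = 0 \<and> (\<forall>x. h x = of_real (norm (h x)))}"
  define S where "S h e = {x. norm (h x) < e}" for h :: "'a \<Rightarrow> complex" and e :: real
  define \<B> where "\<B> = {S h e | h e. h \<in> N \<and> e > 0}"
  have \<B>_I: "S h e \<in> \<B>" if "h \<in> N" "e > 0" for h e
    unfolding \<B>_def using that by auto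
  have "\<exists>p\<in>ultrafilters. \<B> \<subseteq> p"
  proof (rule ultrafilter_extends_directed)
    have "(\<lambda>x. 0) \<in> N" using wap_space_const[OF \<phi>, of 0] by (simp add: N_def WAP_const)
    from \<B>_I[OF this zero_less_one] show "\<B> \<noteq> {}" by auto
    show "{} \<notin> \<B>"
    proof
      assume "{} \<in> \<B>"
      then obtain h e where h: "h \<in> N" "e > 0" "S h e = {}" by (auto simp: \<B>_def)
      then have e: "norm (h x) \<ge> e" for x by (auto simp: S_def not_less[symmetric])
      have hW: "h \<in> WAP" "\<phi> h = 0" using h(1) by (simp_all add: N_def)
      have "h x \<noteq> 0" for x using e[of x] h(2) by auto
      then have "(\<lambda>x. h x * inverse (h x)) = (\<lambda>x. 1)" by simp
      then have "\<phi> h * \<phi> (\<lambda>x. inverse (h x)) = 1"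
        using wap_space_mult[OF \<phi> hW(1) WAP_inverse[OF hW(1) h(2) e]] wap_space_const[OF \<phi>, of 1] by simp
      then show False using hW(2) by simp
    qed
    fix A B assume "A \<in> \<B>" "B \<in> \<B>"
    then obtain h e k d where h: "h \<in> N" "e > 0" "A = S h e" and k: "k \<in> N" "d > 0" "B = S k d"
      unfolding \<B>_def by auto
    have norm_sum: "h x + k x = of_real (norm (h x) + norm (k x))" for x
      using h(1) k(1) by (simp add: N_def)
    then have norm_sum': "norm (h x + k x) = norm (h x) + norm (k x)" for x
      by (metis norm_of_real abs_of_nonneg add_nonneg_nonneg norm_ge_zero)
    have "(\<lambda>x. h x + k x) \<in> N"
      using h(1) k(1) norm_sum wap_space_add[OF \<phi>, of h k]
      unfolding N_def mem_Collect_eq norm_sum' by (simp add: WAP_add)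
    then have "S (\<lambda>x. h x + k x) (min e d) \<in> \<B>"
      using h(2) k(2) by (intro \<B>_I) simp_all
    moreover have "S (\<lambda>x. h x + k x) (min e d) \<subseteq> A \<inter> B"
    proof
      fix x assume "x \<in> S (\<lambda>x. h x + k x) (min e d)"
      then have "norm (h x) + norm (k x) < min e d" by (simp add: S_def norm_sum')
      then have "norm (h x) < e" "norm (k x) < d"
        using norm_ge_zero[of "h x"] norm_ge_zero[of "k x"] by linarith+
      then show "x \<in> A \<inter> B" by (simp add: h(3) k(3) S_def)
    qed
    ultimately show "\<exists>C\<in>\<B>. C \<subseteq> A \<inter> B" by (rule bexI[rotated])
  qed
  then obtain p where p: "p \<in> ultrafilters" "\<B> \<subseteq> p" by (rule bexE)
  have "ulim p f = \<phi> f" if f: "f \<in> WAP" for f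
  proof (rule ulim_eqI[OF p(1)], rule tendstoI)
    fix e :: real assume e: "e > 0"
    let ?d = "\<lambda>x. f x + - \<phi> f"
    \<comment> \<open>The squared modulus of the deviation from \<open>\<phi> f\<close>:
      multiplicativity puts it into the kernel, and its smallness means that \<open>f\<close> is
      close to \<open>\<phi> f\<close>.\<close>
    let ?h = "\<lambda>x. ?d x * cnj (?d x)"
    have d: "?d \<in> WAP" by (intro WAP_add f WAP_const)
    have "\<phi> ?d = 0" using wap_space_add[OF \<phi> f WAP_const[of "- \<phi> f"]] wap_space_const[OF \<phi>] by simp
    then have "\<phi> ?h = 0" using wap_space_mult[OF \<phi> d WAP_cnj[OF d]] by simp
    moreover have sq: "?h x = of_real ((norm (?d x))\<^sup>2)" for x by (rule complex_norm_square[symmetric])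
    then have normh: "norm (?h x) = (norm (?d x))\<^sup>2" for x by (metis norm_of_real abs_of_nonneg zero_le_power2)
    ultimately have "?h \<in> N"
      unfolding N_def using WAP_mult[OF d WAP_cnj[OF d]] sq by (simp only: mem_Collect_eq normh) simp
    then have "S ?h (e\<^sup>2) \<in> \<B>" using e by (intro \<B>_I) simp_all
    then have "S ?h (e\<^sup>2) \<in> p" by (rule subsetD[OF p(2)])
    then show "eventually (\<lambda>x. dist (f x) (\<phi> f) < e) (ufilter p)"
      unfolding eventually_ufilter[OF p(1)]
    proof (rule ultrafilters_mono[OF p(1)], intro subsetI CollectI)
      fix x assume "x \<in> S ?h (e\<^sup>2)"
      then have "(norm (?d x))\<^sup>2 < e\<^sup>2" by (simp only: S_def mem_Collect_eq normh)
      then have "norm (?d x) < e" using e by (simp add: power_less_imp_less_base)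
      then show "dist (f x) (\<phi> f) < e" by (simp add: dist_norm)
    qed
  qed
  then have "\<phi> = wap_lim p"
    by (intro wap_space_eqI[OF \<phi> wap_lim_in_space[OF p(1)]]) (simp add: wap_lim_apply)
  then show "\<phi> \<in> wap_lim ` ultrafilters" using p(1) by (rule image_eqI)
qed (auto intro: wap_lim_in_space)

text \<open>A continuous surjection from a compact onto a Hausdorff space. The quotient property
  transfers continuity of the multiplication, closedness gives the homeomorphism.\<close>

lemma quotient_map_wap_lim: "quotient_map beta_topology wap_topology wap_lim"
  and closed_map_wap_lim: "closed_map beta_topology wap_topology wap_lim"
  using continuous_imp_quotient_map[OF continuous_map_wap_lim compact_space_beta Hausdorff_wap]
    continuous_imp_closed_map[OF continuous_map_wap_lim compact_space_beta Hausdorff_wap]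
  by (simp_all add: topspace_beta topspace_wap wap_lim_surj)

lemma wap_closure_points: "wap_topology closure_of (range wap_point) = wap_space"
proof
  have "wap_lim ` ultrafilters \<subseteq> wap_topology closure_of (wap_lim ` range principal)"
    using continuous_map_image_closure_subset[OF continuous_map_wap_lim] by (simp only: beta_closure_principal[symmetric])
  then show "wap_space \<subseteq> wap_topology closure_of (range wap_point)"
    by (simp add: wap_lim_surj image_image wap_lim_principal)
qed (use closure_of_subset_topspace[of wap_topology] in \<open>simp add: topspace_wap\<close>)

text \<open>Uniqueness holds because principal ultrafilters are dense and the target is
  Hausdorff.\<close>

lemma canonical_map_eq: "canonical_map = restrict wap_lim ultrafilters"
  unfolding canonical_map_def
proof (rule the_equality, intro conjI allI)
  show "restrict wap_lim ultrafilters \<in> extensional ultrafilters" by simp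
  show "continuous_map beta_topology wap_topology (restrict wap_lim ultrafilters)"
    by (rule continuous_map_eq[OF continuous_map_wap_lim]) (simp add: topspace_beta)
  show "restrict wap_lim ultrafilters (principal \<gamma>) = wap_point \<gamma>" for \<gamma> :: 'a
    by (simp add: principal_ultrafilter wap_lim_principal)
next
  fix \<pi> :: "'a set set \<Rightarrow> ('a \<Rightarrow> complex) \<Rightarrow> complex"
  assume \<pi>: "\<pi> \<in> extensional ultrafilters \<and> continuous_map beta_topology wap_topology \<pi> \<and>
    (\<forall>\<gamma>. \<pi> (principal \<gamma>) = wap_point \<gamma>)"
  show "\<pi> = restrict wap_lim ultrafilters"
  proof (rule extensionalityI)
    show "\<pi> \<in> extensional ultrafilters" using \<pi> by simp
    fix p :: "'a set set" assume p: "p \<in> ultrafilters"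
    have "\<pi> p = wap_lim p"
    proof (rule forall_in_closure_of_eq[OF _ Hausdorff_wap _ continuous_map_wap_lim])
      show "p \<in> beta_topology closure_of (range principal)" using p by (simp add: beta_closure_principal)
    qed (use \<pi> in \<open>auto simp: wap_lim_principal\<close>)
    then show "\<pi> p = restrict wap_lim ultrafilters p" using p by simp
  qed simp
qed

lemma canonical_map_apply: "p \<in> ultrafilters \<Longrightarrow> canonical_map p = wap_lim p"
  by (simp add: canonical_map_eq)

section \<open>The multiplication\<close>

lemma wap_lim_mult_L:
  assumes p: "p \<in> ultrafilters" and q: "q \<in> ultrafilters"
  shows "wap_lim (ultra_mult_L p q) = wap_lim (ultra_mult_R p q)"
  by (rule wap_lim_eqI[OF ultra_mult_L_ultrafilter[OF p q] ultra_mult_R_ultrafilter[OF p q]])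
     (simp add: WAP_ulim_eq[OF _ p q])

text \<open>In \<open>pq\<close> the inner limit sees left translates of \<open>f\<close>, so
  \<open>q\<close> may be exchanged; in \<open>p \<cdot> q\<close> it sees right translates, so
  \<open>p\<close> may be exchanged. Weak almost periodicity allows the passage between the two
  products.\<close>

lemma wap_lim_mult_cong:
  assumes p: "p \<in> ultrafilters" "p' \<in> ultrafilters" "wap_lim p = wap_lim p'"
    and q: "q \<in> ultrafilters" "q' \<in> ultrafilters" "wap_lim q = wap_lim q'"
  shows "wap_lim (ultra_mult_R p q) = wap_lim (ultra_mult_R p' q')"
proof (rule wap_lim_eqI[OF ultra_mult_R_ultrafilter[OF p(1) q(1)] ultra_mult_R_ultrafilter[OF p(2) q(2)]])
  fix f :: "'a \<Rightarrow> complex" assume f: "f \<in> WAP"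
  note fl = WAP_linfty[OF f]
  have "ulim (ultra_mult_R p q) f = ulim (ultra_mult_R p q') f"
    unfolding ulim_ultra_mult_R[OF p(1) q(1) fl] ulim_ultra_mult_R[OF p(1) q(2) fl]
    using wap_lim_eqD[OF q(3) WAP_translate_left[OF f]] by simp
  also have "\<dots> = ulim (ultra_mult_L p q') f" by (rule WAP_ulim_eq[OF f p(1) q(2)])
  also have "\<dots> = ulim (ultra_mult_L p' q') f"
    unfolding ulim_ultra_mult_L[OF p(1) q(2) fl] ulim_ultra_mult_L[OF p(2) q(2) fl]
    using wap_lim_eqD[OF p(3) WAP_translate_right[OF f]] by simp
  also have "\<dots> = ulim (ultra_mult_R p' q') f" by (rule WAP_ulim_eq[OF f p(2) q(2), symmetric])
  finally show "ulim (ultra_mult_R p q) f = ulim (ultra_mult_R p' q') f" .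
qed

text \<open>The product of ultrafilters descends to the quotient and has all properties that define
  \<open>wap_mult\<close>; two separately continuous operations that agree on the dense set of group
  points are equal.\<close>

lemma wap_mult_wap_lim:
  fixes p q :: "'a::group_add set set"
  assumes "p \<in> ultrafilters" "q \<in> ultrafilters"
  shows "wap_mult (wap_lim p, wap_lim q) = wap_lim (ultra_mult_R p q)"
proof -
  let ?W = "wap_space :: (('a \<Rightarrow> complex) \<Rightarrow> complex) set"
  let ?T = "wap_topology :: (('a \<Rightarrow> complex) \<Rightarrow> complex) topology"
  define is_mult where "is_mult m \<longleftrightarrow>
     m \<in> (?W \<times> ?W) \<rightarrow>\<^sub>E ?W \<and>
     (\<forall>x\<in>?W. \<forall>y\<in>?W. \<forall>z\<in>?W. m (m (x, y), z) = m (x, m (y, z))) \<and>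
     (\<forall>\<gamma> \<delta>. m (wap_point \<gamma>, wap_point \<delta>) = wap_point (\<gamma> + \<delta>)) \<and>
     (\<forall>x\<in>?W. continuous_map ?T ?T (\<lambda>y. m (x, y))) \<and>
     (\<forall>y\<in>?W. continuous_map ?T ?T (\<lambda>x. m (x, y)))" for m
  define c where "c = inv_into ultrafilters (wap_lim :: 'a set set \<Rightarrow> _)"
  have c: "c \<phi> \<in> ultrafilters" "wap_lim (c \<phi>) = \<phi>" if "\<phi> \<in> ?W" for \<phi>
    using that inv_into_into[of \<phi> wap_lim ultrafilters] f_inv_into_f[of \<phi> wap_lim ultrafilters]
    by (simp_all add: c_def wap_lim_surj)
  define m where "m = restrict (\<lambda>(\<phi>, \<psi>). wap_lim (ultra_mult_R (c \<phi>) (c \<psi>))) (?W \<times> ?W)"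
  have m: "m (wap_lim p, wap_lim q) = wap_lim (ultra_mult_R p q)"
    if "p \<in> ultrafilters" "q \<in> ultrafilters" for p q
  proof -
    note W = wap_lim_in_space[OF that(1)] wap_lim_in_space[OF that(2)]
    have "m (wap_lim p, wap_lim q) = wap_lim (ultra_mult_R (c (wap_lim p)) (c (wap_lim q)))"
      using W by (simp add: m_def)
    also have "\<dots> = wap_lim (ultra_mult_R p q)"
      by (rule wap_lim_mult_cong) (use W that c in simp_all)
    finally show ?thesis .
  qed
  have lift: "\<exists>p\<in>ultrafilters. \<phi> = wap_lim p" if "\<phi> \<in> ?W" for \<phi>
    using that by (auto simp: wap_lim_surj[symmetric])
  have "is_mult m"
    unfolding is_mult_def
  proof (intro conjI ballI allI)
    show "m \<in> (?W \<times> ?W) \<rightarrow>\<^sub>E ?W"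
    proof (rule PiE_I)
      fix x assume "x \<in> ?W \<times> ?W"
      then show "m x \<in> ?W"
        by (auto simp: m_def intro!: wap_lim_in_space ultra_mult_R_ultrafilter c)
    next
      fix x assume "x \<notin> ?W \<times> ?W"
      then show "m x = undefined" by (simp only: m_def restrict_def if_False)
    qed
  next
    fix x y z assume W: "x \<in> ?W" "y \<in> ?W" "z \<in> ?W"
    from lift[OF W(1)] lift[OF W(2)] lift[OF W(3)] obtain p q r
      where u: "p \<in> ultrafilters" "q \<in> ultrafilters" "r \<in> ultrafilters"
        and eq: "x = wap_lim p" "y = wap_lim q" "z = wap_lim r" by (elim bexE)
    show "m (m (x, y), z) = m (x, m (y, z))"
      unfolding eq using u by (simp add: m ultra_mult_R_ultrafilter ultra_mult_R_assoc)
  next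
    fix \<gamma> \<delta> :: 'a
    show "m (wap_point \<gamma>, wap_point \<delta>) = wap_point (\<gamma> + \<delta>)"
      by (simp add: wap_lim_principal[symmetric] m principal_ultrafilter ultra_mult_R_principal)
  next
    fix x assume "x \<in> ?W"
    from lift[OF this] obtain p where p: "p \<in> ultrafilters" "x = wap_lim p" by (rule bexE)
    \<comment> \<open>Continuity in the second variable is taken from the other product, which has
      the same image in the quotient.\<close>
    have "continuous_map beta_topology ?T (wap_lim \<circ> ultra_mult_L p)"
      by (rule continuous_map_compose[OF continuous_map_ultra_mult_L[OF p(1)] continuous_map_wap_lim])
    then have "continuous_map beta_topology ?T ((\<lambda>y. m (x, y)) \<circ> wap_lim)"
      by (rule continuous_map_eq) (simp add: topspace_beta m p wap_lim_mult_L)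
    then show "continuous_map ?T ?T (\<lambda>y. m (x, y))"
      by (rule continuous_compose_quotient_map[OF quotient_map_wap_lim])
  next
    fix y assume "y \<in> ?W"
    from lift[OF this] obtain q where q: "q \<in> ultrafilters" "y = wap_lim q" by (rule bexE)
    have "continuous_map beta_topology ?T (wap_lim \<circ> (\<lambda>p. ultra_mult_R p q))"
      by (rule continuous_map_compose[OF continuous_map_ultra_mult_R[OF q(1)] continuous_map_wap_lim])
    then have "continuous_map beta_topology ?T ((\<lambda>x. m (x, y)) \<circ> wap_lim)"
      by (rule continuous_map_eq) (simp add: topspace_beta m q)
    then show "continuous_map ?T ?T (\<lambda>x. m (x, y))"
      by (rule continuous_compose_quotient_map[OF quotient_map_wap_lim])
  qed
  moreover have "m' = m" if m': "is_mult m'" for m'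
  proof (rule extensionalityI)
    note M = \<open>is_mult m\<close>[unfolded is_mult_def] m'[unfolded is_mult_def]
    show "m' \<in> extensional (?W \<times> ?W)" "m \<in> extensional (?W \<times> ?W)"
      using M by (simp_all add: PiE_def)
    fix z assume "z \<in> ?W \<times> ?W"
    then obtain x y where z: "z = (x, y)" and x: "x \<in> ?W" and y: "y \<in> ?W" by (rule SigmaE)
    have xc: "x \<in> ?T closure_of (range wap_point)" and yc: "y \<in> ?T closure_of (range wap_point)"
      using x y by (simp_all add: wap_closure_points)
    have pt: "wap_point \<gamma> \<in> ?W" for \<gamma> :: 'a
      using wap_lim_in_space[OF principal_ultrafilter[of \<gamma>]] by (simp add: wap_lim_principal)
    \<comment> \<open>Density is used one variable at a time: the second with a group point on the
      left, then the first.\<close>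
    have 1: "m' (wap_point \<gamma>, y) = m (wap_point \<gamma>, y)" for \<gamma>
      by (rule forall_in_closure_of_eq[OF yc Hausdorff_wap, of "\<lambda>y. m' (wap_point \<gamma>, y)" "\<lambda>y. m (wap_point \<gamma>, y)"])
         (use M pt in auto)
    have "m' (x, y) = m (x, y)"
      by (rule forall_in_closure_of_eq[OF xc Hausdorff_wap, of "\<lambda>x. m' (x, y)" "\<lambda>x. m (x, y)"])
         (use M y 1 in auto)
    then show "m' z = m z" by (simp add: z)
  qed
  ultimately have "(THE m. is_mult m) = m" by (rule the_equality)
  then have "wap_mult = m" unfolding wap_mult_def is_mult_def .
  then show ?thesis using m[OF assms] by simp
qed

lemma wap_lim_remainder_iff:
  assumes p: "p \<in> ultrafilters"
  shows "wap_lim p \<in> wap_remainder \<longleftrightarrow> p \<in> beta_remainder"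
proof -
  have eq: "p = principal x" if "wap_lim p = wap_point x" for x
  proof (rule ultrafilter_singleton[OF p])
    have "ulim p (indicator {x}) = ulim (principal x) (indicator {x})"
      by (rule wap_lim_eqD[OF _ WAP_indicator_singleton]) (simp add: that wap_lim_principal)
    then show "{x} \<in> p" by (simp add: ulim_principal ulim_indicator[OF p] split: if_splits)
  qed
  have "wap_lim p \<in> range wap_point \<longleftrightarrow> p \<in> range principal"
  proof
    assume "wap_lim p \<in> range wap_point"
    then obtain x where "wap_lim p = wap_point x" by (rule imageE)
    from eq[OF this] show "p \<in> range principal" by simp
  next
    assume "p \<in> range principal"
    then obtain x where "p = principal x" by (rule imageE)
    then show "wap_lim p \<in> range wap_point" by (simp add: wap_lim_principal)
  qed
  then show ?thesis
    using p wap_lim_in_space[OF p] by (simp add: wap_remainder_def beta_remainder_def)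
qed

section \<open>The closure of the products of remainder points\<close>

lemma ultra_mult_R_in_Z_R: "p \<in> beta_remainder \<Longrightarrow> q \<in> beta_remainder \<Longrightarrow> ultra_mult_R p q \<in> Z_R"
  unfolding Z_R_def
  by (rule subsetD[OF closure_of_subset])
     (auto simp: topspace_beta intro: ultra_mult_R_ultrafilter beta_remainder_ultrafilter)

lemma ultra_mult_L_in_Z_L: "p \<in> beta_remainder \<Longrightarrow> q \<in> beta_remainder \<Longrightarrow> ultra_mult_L p q \<in> Z_L"
  unfolding Z_L_def
  by (rule subsetD[OF closure_of_subset])
     (auto simp: topspace_beta intro: ultra_mult_L_ultrafilter beta_remainder_ultrafilter)

lemma closedin_Z: "closedin beta_topology (Z_R \<union> Z_L)"
  unfolding Z_R_def Z_L_def by (intro closedin_Un closedin_closure_of)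

lemma closedin_beta_avoiding: "closedin beta_topology {p \<in> ultrafilters. A \<notin> p}"
proof -
  have "topspace beta_topology - {p \<in> ultrafilters. A \<notin> p} = {p \<in> ultrafilters. A \<in> p}"
    by (auto simp: topspace_beta)
  then show ?thesis
    using openin_beta_basic[of A] by (simp add: closedin_def topspace_beta)
qed

lemma Z_avoiding:
  assumes "\<And>p q. p \<in> beta_remainder \<Longrightarrow> q \<in> beta_remainder \<Longrightarrow> A \<notin> ultra_mult_R p q \<and> A \<notin> ultra_mult_L p q"
    and "p \<in> Z_R \<union> Z_L"
  shows "A \<notin> p"
proof -
  have "Z_R \<subseteq> {p \<in> ultrafilters. A \<notin> p}" "Z_L \<subseteq> {p \<in> ultrafilters. A \<notin> p}"
    unfolding Z_R_def Z_L_def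
    by (rule closure_of_minimal[OF _ closedin_beta_avoiding];
        use assms(1) in \<open>auto intro: ultra_mult_R_ultrafilter ultra_mult_L_ultrafilter beta_remainder_ultrafilter\<close>)+
  then show ?thesis using assms(2) by auto
qed

text \<open>\<open>Z\<close> is closed, so some basic neighbourhood of \<open>p\<close> misses it;
  \<open>A\<close> is the set that determines this neighbourhood.\<close>

lemma Z_neighbourhood:
  assumes p: "p \<in> ultrafilters" "p \<notin> Z_R \<union> Z_L"
  obtains A where "A \<in> p"
    "\<And>q r. q \<in> beta_remainder \<Longrightarrow> r \<in> beta_remainder \<Longrightarrow> A \<notin> ultra_mult_R q r \<and> A \<notin> ultra_mult_L q r"
proof -
  have "openin beta_topology (ultrafilters - (Z_R \<union> Z_L))"
    using openin_diff[OF openin_topspace closedin_Z] by (simp add: topspace_beta)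
  then have "\<forall>p\<in>ultrafilters - (Z_R \<union> Z_L). \<exists>A\<in>p. {q \<in> ultrafilters. A \<in> q} \<subseteq> ultrafilters - (Z_R \<union> Z_L)"
    unfolding openin_beta_iff by (rule conjunct2)
  moreover have "p \<in> ultrafilters - (Z_R \<union> Z_L)" using p by simp
  ultimately have "\<exists>A\<in>p. {q \<in> ultrafilters. A \<in> q} \<subseteq> ultrafilters - (Z_R \<union> Z_L)"
    by (rule bspec)
  then obtain A where A: "A \<in> p" "{q \<in> ultrafilters. A \<in> q} \<subseteq> ultrafilters - (Z_R \<union> Z_L)"
    by (rule bexE)
  have "A \<notin> ultra_mult_R q r \<and> A \<notin> ultra_mult_L q r" if qr: "q \<in> beta_remainder" "r \<in> beta_remainder" for q r
  proof -
    have "A \<notin> z" if "z \<in> ultrafilters" "z \<in> Z_R \<union> Z_L" for z using A(2) that by auto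
    then show ?thesis
      using ultra_mult_R_in_Z_R[OF qr] ultra_mult_L_in_Z_L[OF qr]
        ultra_mult_R_remainder[OF qr] ultra_mult_L_remainder[OF qr]
      by (simp add: beta_remainder_ultrafilter)
  qed
  with A(1) show ?thesis by (rule that)
qed

text \<open>
  The chosen points \<open>b n\<close> are so sparse that every quotient occurs only finitely often, hence two
  different translates of their set have finite intersection.
\<close>

lemma thin_subset_exists:
  fixes A :: "'a::group_add set"
  assumes count: "countable (UNIV :: 'a set)" and A: "infinite A"
  obtains B where "B \<subseteq> A" "infinite B"
    "\<And>p q. p \<in> beta_remainder \<Longrightarrow> q \<in> beta_remainder \<Longrightarrow> B \<notin> ultra_mult_R p q \<and> B \<notin> ultra_mult_L p q"
proof -
  define e where "e = from_nat_into (UNIV :: 'a set)"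
  have e: "\<exists>k. e k = x" for x
    using range_from_nat_into[OF _ count] by (metis e_def UNIV_not_empty UNIV_I imageE)
  \<comment> \<open>At stage \<open>n\<close> the new point avoids the group elements
    \<open>e 0, \<dots>, e n\<close> and their inverses as quotients with earlier points, on both
    sides.\<close>
  define good where "good b n r \<longleftrightarrow> r \<in> A \<and> (\<forall>i<n. r \<noteq> b i \<and>
      (\<forall>k\<le>n. r \<noteq> e k + b i \<and> e k + r \<noteq> b i \<and> r \<noteq> b i + e k \<and> r + e k \<noteq> b i))"
    for b :: "nat \<Rightarrow> 'a" and n r
  have "\<exists>b. \<forall>n. good b n (b n)"
  proof (rule dependent_wellorder_choice)
    show "good b n r = good c n r" if "\<And>i. i < n \<Longrightarrow> b i = c i" for b c n r
      using that by (simp add: good_def)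
    fix n and b :: "nat \<Rightarrow> 'a"
    \<comment> \<open>The forbidden equations solved for \<open>r\<close>; only finitely many values
      arise.\<close>
    let ?bad = "\<Union>i\<in>{..<n}. \<Union>k\<in>{..n}. {b i, e k + b i, - e k + b i, b i + e k, b i - e k}"
    have "\<not> A \<subseteq> ?bad" using A finite_subset[of A ?bad] by auto
    then obtain r where r: "r \<in> A" "r \<notin> ?bad" by (meson subsetI)
    have not_bad: "r \<notin> {b i, e k + b i, - e k + b i, b i + e k, b i - e k}" if "i < n" "k \<le> n" for i k
      using r(2) that unfolding UN_iff by (meson atMost_iff lessThan_iff)
    have "good b n r"
      unfolding good_def
    proof (intro conjI allI impI r(1))
      fix i k assume "i < n" "k \<le> n"
      note nb = not_bad[OF this]
      then show "r \<noteq> e k + b i" "r \<noteq> b i + e k" by auto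
      show "e k + r \<noteq> b i"
      proof
        assume "e k + r = b i"
        then have "r = - e k + b i" by (metis minus_add_cancel)
        then show False using nb by simp
      qed
      show "r + e k \<noteq> b i"
      proof
        assume "r + e k = b i"
        then have "r = b i - e k" by (simp add: eq_diff_eq)
        then show False using nb by simp
      qed
    next
      fix i assume "i < n"
      then show "r \<noteq> b i" using not_bad[of i 0] by simp
    qed
    then show "\<exists>r. good b n r" by (rule exI)
  qed
  then obtain b where b: "\<And>n. good b n (b n)" by auto
  have neq: "b n \<noteq> b i" if "i < n" for i n using b[of n] that by (simp add: good_def)
  have inj: "inj b"
  proof (rule injI)
    fix i j assume eq: "b i = b j"
    then show "i = j" using neq[of i j] neq[of j i] by (cases i j rule: linorder_cases) auto
  qed
  \<comment> \<open>The later of the two points was chosen with the quotient \<open>e k\<close>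
    forbidden if \<open>k\<close> did not exceed its index; which of the two orientations applies
    depends on whether \<open>n\<close> or \<open>m\<close> is larger.\<close>
  have left: "n < k" if "b n = e k + b m" "n \<noteq> m" for n m k
  proof (cases "m < n")
    case True
    then show ?thesis using b[of n] that(1) by (force simp: good_def not_less[symmetric])
  next
    case False
    then have "n < m" using that(2) by simp
    moreover from this have "m < k" using b[of m] that(1) unfolding good_def by (metis not_less)
    ultimately show ?thesis by simp
  qed
  have right: "n < k" if "b n = b m + e k" "n \<noteq> m" for n m k
  proof (cases "m < n")
    case True
    then show ?thesis using b[of n] that(1) by (force simp: good_def not_less[symmetric])
  next
    case False
    then have "n < m" using that(2) by simp
    moreover from this have "m < k" using b[of m] that(1) unfolding good_def by (metis not_less)
    ultimately show ?thesis by simp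
  qed
  let ?B = "range b"
  have fin_left: "finite ({y. x + y \<in> ?B} \<inter> {y. z + y \<in> ?B})" if "x \<noteq> z" for x z
  proof -
    \<comment> \<open>A common point of both translates gives two members of the set with quotient
      \<open>e k\<close>, hence an index below \<open>k\<close>.\<close>
    obtain k where k: "e k = x - z" using e by blast
    have "{y. x + y \<in> ?B} \<inter> {y. z + y \<in> ?B} \<subseteq> (\<lambda>n. - x + b n) ` {..<k}"
    proof
      fix y assume "y \<in> {y. x + y \<in> ?B} \<inter> {y. z + y \<in> ?B}"
      then obtain n m where nm: "x + y = b n" "z + y = b m" by auto
      have "b n = e k + b m" by (simp add: k nm[symmetric] add.assoc[symmetric])
      moreover have "x + y \<noteq> z + y" using that by simp
      then have "n \<noteq> m" using nm by auto
      ultimately have "n < k" by (rule left)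
      moreover have "y = - x + b n" by (simp add: nm(1)[symmetric])
      ultimately show "y \<in> (\<lambda>n. - x + b n) ` {..<k}" by auto
    qed
    then show ?thesis by (rule finite_subset) simp
  qed
  have fin_right: "finite ({y. y + x \<in> ?B} \<inter> {y. y + z \<in> ?B})" if "x \<noteq> z" for x z
  proof -
    obtain k where k: "e k = - z + x" using e by blast
    have "{y. y + x \<in> ?B} \<inter> {y. y + z \<in> ?B} \<subseteq> (\<lambda>n. b n - x) ` {..<k}"
    proof
      fix y assume "y \<in> {y. y + x \<in> ?B} \<inter> {y. y + z \<in> ?B}"
      then obtain n m where nm: "y + x = b n" "y + z = b m" by auto
      have "b n = b m + e k" by (simp add: k nm[symmetric] add.assoc)
      moreover have "y + x \<noteq> y + z" using that by simp
      then have "n \<noteq> m" using nm by auto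
      ultimately have "n < k" by (rule right)
      moreover have "y = b n - x" by (simp add: nm(1)[symmetric])
      ultimately show "y \<in> (\<lambda>n. b n - x) ` {..<k}" by auto
    qed
    then show ?thesis by (rule finite_subset) simp
  qed
  \<comment> \<open>Two sections in the free ultrafilter \<open>q\<close> would meet in an infinite
    set, so at most one belongs to \<open>q\<close>, and \<open>p\<close> contains no set with at
    most one element.\<close>
  have thin: "{x. F x \<in> q} \<notin> p"
    if F: "\<And>x z. x \<noteq> z \<Longrightarrow> finite (F x \<inter> F z)" and p: "p \<in> beta_remainder" and q: "q \<in> beta_remainder"
    for F :: "'a \<Rightarrow> 'a set" and p q
  proof -
    have unique: "x = z" if "F x \<in> q" "F z \<in> q" for x z
      using F[of x z] beta_remainder_finite[OF q, of "F x \<inter> F z"]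
        ultrafilters_Int[OF beta_remainder_ultrafilter[OF q] that] by auto
    have "finite {x. F x \<in> q}"
    proof (cases "\<exists>z. F z \<in> q")
      case True
      then obtain z where "F z \<in> q" by (rule exE)
      then have "{x. F x \<in> q} \<subseteq> {z}" using unique by auto
      then show ?thesis by (rule finite_subset) simp
    qed simp
    then show ?thesis by (rule beta_remainder_finite[OF p])
  qed
  show ?thesis
  proof (rule that[of ?B])
    show "?B \<subseteq> A" using b by (auto simp: good_def)
    show "infinite ?B" using inj by (rule range_inj_infinite)
    show "?B \<notin> ultra_mult_R p q \<and> ?B \<notin> ultra_mult_L p q"
      if p: "p \<in> beta_remainder" and q: "q \<in> beta_remainder" for p q
      unfolding mem_ultra_mult_R mem_ultra_mult_L
      using thin[OF fin_left p q] thin[OF fin_right q p] by simp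
  qed
qed

text \<open>A basic neighbourhood of a free ultrafilter comes from an infinite set; any free
  ultrafilter on a thin subset of it stays in the neighbourhood and lies outside
  \<open>Z\<close>.\<close>

lemma remainder_minus_Z_dense:
  assumes count: "countable (UNIV :: 'a::group_add set)"
  shows "(subtopology beta_topology beta_remainder) closure_of (beta_remainder - (Z_R \<union> Z_L)) =
    (beta_remainder :: 'a set set set)"
proof
  have "topspace (subtopology beta_topology beta_remainder) \<subseteq> (beta_remainder :: 'a set set set)"
    by simp
  then show "(subtopology beta_topology beta_remainder) closure_of (beta_remainder - (Z_R \<union> Z_L))
      \<subseteq> (beta_remainder :: 'a set set set)"
    by (rule order_trans[OF closure_of_subset_topspace])
  show "beta_remainder \<subseteq> (subtopology beta_topology beta_remainder) closure_of
      (beta_remainder - (Z_R \<union> Z_L) :: 'a set set set)"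
  proof
    fix p :: "'a set set" assume p: "p \<in> beta_remainder"
    show "p \<in> (subtopology beta_topology beta_remainder) closure_of (beta_remainder - (Z_R \<union> Z_L))"
      unfolding in_closure_of
    proof (intro conjI allI impI)
      show "p \<in> topspace (subtopology beta_topology beta_remainder)"
        using p by (simp add: topspace_beta beta_remainder_ultrafilter)
      fix T assume T: "p \<in> T \<and> openin (subtopology beta_topology beta_remainder) T"
      then obtain U where U: "openin beta_topology U" "T = U \<inter> beta_remainder"
        unfolding openin_subtopology by auto
      have "\<forall>p\<in>U. \<exists>A\<in>p. {q \<in> ultrafilters. A \<in> q} \<subseteq> U"
        using U(1) unfolding openin_beta_iff by (rule conjunct2)
      moreover have "p \<in> U" using T U(2) by simp
      ultimately have "\<exists>A\<in>p. {q \<in> ultrafilters. A \<in> q} \<subseteq> U" by (rule bspec)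
      then obtain A where A: "A \<in> p" "{q \<in> ultrafilters. A \<in> q} \<subseteq> U" by (rule bexE)
      have "infinite A" using beta_remainder_finite[OF p] A(1) by auto
      then obtain B where B: "B \<subseteq> A" "infinite B"
        "\<And>p q. p \<in> beta_remainder \<Longrightarrow> q \<in> beta_remainder \<Longrightarrow> B \<notin> ultra_mult_R p q \<and> B \<notin> ultra_mult_L p q"
        using thin_subset_exists[OF count] by metis
      from free_ultrafilter_exists[OF B(2)] obtain q where q: "q \<in> beta_remainder" "B \<in> q" by (rule bexE)
      note q' = beta_remainder_ultrafilter[OF q(1)]
      have "q \<notin> Z_R \<union> Z_L" using Z_avoiding[OF B(3)] q(2) by blast
      moreover have "q \<in> T"
        using ultrafilters_mono[OF q' q(2) B(1)] q(1) q' U(2) subsetD[OF A(2), of q] by simp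
      ultimately show "\<exists>y. y \<in> beta_remainder - (Z_R \<union> Z_L) \<and> y \<in> T"
        using q(1) by (intro exI[of _ q]) simp
    qed
  qed
qed

section \<open>Pulling back the closure of the products, and the homeomorphism\<close>

lemma wap_remainder_sq_eq:
  "wap_remainder_sq = {wap_lim (ultra_mult_R p q) | p q. p \<in> beta_remainder \<and> q \<in> beta_remainder}"
proof (intro equalityI subsetI)
  fix w :: "('a \<Rightarrow> complex) \<Rightarrow> complex" assume "w \<in> wap_remainder_sq"
  then obtain y z where w: "w = wap_mult (y, z)" "y \<in> wap_remainder" "z \<in> wap_remainder"
    by (auto simp: wap_remainder_sq_def)
  then have "y \<in> wap_lim ` ultrafilters" "z \<in> wap_lim ` ultrafilters"
    by (simp_all add: wap_remainder_def wap_lim_surj)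
  then obtain p q where p: "p \<in> ultrafilters" "y = wap_lim p" and q: "q \<in> ultrafilters" "z = wap_lim q"
    by auto
  have "w = wap_lim (ultra_mult_R p q)" using w(1) by (simp add: p q wap_mult_wap_lim)
  moreover have "p \<in> beta_remainder" "q \<in> beta_remainder"
    using w(2,3) by (simp_all add: p q wap_lim_remainder_iff)
  ultimately show "w \<in> {wap_lim (ultra_mult_R p q) | p q. p \<in> beta_remainder \<and> q \<in> beta_remainder}"
    by auto
next
  fix w :: "('a \<Rightarrow> complex) \<Rightarrow> complex"
  assume "w \<in> {wap_lim (ultra_mult_R p q) | p q. p \<in> beta_remainder \<and> q \<in> beta_remainder}"
  then obtain p q where w: "w = wap_lim (ultra_mult_R p q)" and pq: "p \<in> beta_remainder" "q \<in> beta_remainder"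
    by auto
  note u = beta_remainder_ultrafilter[OF pq(1)] beta_remainder_ultrafilter[OF pq(2)]
  have "w = wap_mult (wap_lim p, wap_lim q)" using w by (simp add: wap_mult_wap_lim u)
  moreover have "wap_lim p \<in> wap_remainder" "wap_lim q \<in> wap_remainder"
    using pq u by (simp_all add: wap_lim_remainder_iff)
  ultimately show "w \<in> wap_remainder_sq" unfolding wap_remainder_sq_def by auto
qed

text \<open>Outside \<open>Z\<close>, the indicator of a set avoiding all products is an admissible
  function that is one at \<open>p\<close> and zero on all products. Conversely, continuity carries
  closures into closures, and both kinds of products have the same images.\<close>

lemma wap_lim_closure_iff:
  fixes p :: "'a::group_add set set"
  assumes p: "p \<in> ultrafilters"
  shows "wap_lim p \<in> wap_topology closure_of wap_remainder_sq \<longleftrightarrow> p \<in> Z_R \<union> Z_L"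
proof
  assume cl: "wap_lim p \<in> wap_topology closure_of wap_remainder_sq"
  show "p \<in> Z_R \<union> Z_L"
  proof (rule ccontr)
    assume "p \<notin> Z_R \<union> Z_L"
    then obtain A where A: "A \<in> p" "\<And>q r. q \<in> beta_remainder \<Longrightarrow> r \<in> beta_remainder \<Longrightarrow>
        A \<notin> ultra_mult_R q r \<and> A \<notin> ultra_mult_L q r"
      using Z_neighbourhood[OF p] by metis
    have W: "indicator A \<in> WAP" by (rule WAP_supported[OF linfty_indicator _ A(2)]) simp_all
    let ?V = "{\<phi> \<in> wap_space. \<phi> (indicator A) \<in> - {0}}"
    have "openin wap_topology ?V" by (rule openin_wap[OF W]) (rule open_Compl[OF closed_singleton])
    moreover have "wap_lim p \<in> ?V"
      using A(1) by (simp add: wap_lim_in_space[OF p] wap_lim_apply[OF W] ulim_indicator[OF p])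
    ultimately have "wap_lim p \<in> ?V \<and> openin wap_topology ?V" by (intro conjI)
    from cl[unfolded in_closure_of, THEN conjunct2, THEN spec, THEN mp, OF this]
    obtain w where w: "w \<in> wap_remainder_sq" "w \<in> ?V" by (elim exE conjE)
    then obtain q r where qr: "w = wap_lim (ultra_mult_R q r)" "q \<in> beta_remainder" "r \<in> beta_remainder"
      unfolding wap_remainder_sq_eq by auto
    have "w (indicator A) = 0"
      using A(2)[OF qr(2,3)] ulim_indicator[OF ultra_mult_R_ultrafilter[OF qr(2,3)[THEN beta_remainder_ultrafilter]], of A]
      by (simp add: qr(1) wap_lim_apply[OF W])
    then show False using w(2) by simp
  qed
next
  note image = continuous_map_image_closure_subset[OF continuous_map_wap_lim]
  have "wap_lim ` Z_R \<subseteq> wap_topology closure_of (wap_remainder_sq :: (('a \<Rightarrow> complex) \<Rightarrow> complex) set)"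
    unfolding Z_R_def by (rule order_trans[OF image closure_of_mono]) (auto simp: wap_remainder_sq_eq)
  moreover have "wap_lim ` Z_L \<subseteq> wap_topology closure_of (wap_remainder_sq :: (('a \<Rightarrow> complex) \<Rightarrow> complex) set)"
    unfolding Z_L_def
    by (rule order_trans[OF image closure_of_mono])
       (auto simp: wap_remainder_sq_eq wap_lim_mult_L beta_remainder_ultrafilter, blast)
  ultimately show "wap_lim p \<in> wap_topology closure_of wap_remainder_sq" if "p \<in> Z_R \<union> Z_L"
    using that by auto
qed

text \<open>Any \<open>B\<close> separating \<open>p\<close> from \<open>q\<close> may be cut down
  by a set \<open>A \<in> p\<close> that avoids all products; the indicator of the intersection is
  then weakly almost periodic and still separates.\<close>

lemma wap_lim_inj_on: "inj_on wap_lim (beta_remainder - (Z_R \<union> Z_L))"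
proof (rule inj_onI, rule ccontr)
  fix p q :: "'a set set"
  assume "p \<in> beta_remainder - (Z_R \<union> Z_L)" "q \<in> beta_remainder - (Z_R \<union> Z_L)"
    and eq: "wap_lim p = wap_lim q" and ne: "p \<noteq> q"
  then have p: "p \<in> ultrafilters" "p \<notin> Z_R \<union> Z_L" and q: "q \<in> ultrafilters"
    by (simp_all add: beta_remainder_ultrafilter)
  obtain A where A: "A \<in> p" "\<And>q r. q \<in> beta_remainder \<Longrightarrow> r \<in> beta_remainder \<Longrightarrow>
      A \<notin> ultra_mult_R q r \<and> A \<notin> ultra_mult_L q r"
    using Z_neighbourhood[OF p] by metis
  obtain B where B: "B \<in> p" "B \<notin> q" using ultrafilters_eqI[OF p(1) q] ne by auto
  have "indicator (A \<inter> B) \<in> WAP"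
    by (rule WAP_supported[OF linfty_indicator _ A(2)]) simp_all
  from wap_lim_eqD[OF eq this] show False
    using A(1) B by (simp add: ulim_indicator p q ultrafilters_Int_iff)
qed

text \<open>\<open>X'\<close> is the full preimage of \<open>Y'\<close>, and on full preimages a
  closed map restricts to a closed map; a continuous closed bijection is a homeomorphism.\<close>

lemma homeomorphic_map_wap_lim:
  fixes X' :: "'a::group_add set set set"
  assumes X': "X' = beta_remainder - (Z_R \<union> Z_L)"
    and Y': "Y' = wap_remainder - wap_topology closure_of wap_remainder_sq"
  shows "homeomorphic_map (subtopology beta_topology X') (subtopology wap_topology Y') wap_lim"
proof (rule bijective_closed_imp_homeomorphic_map)
  have pre: "{p \<in> topspace beta_topology. wap_lim p \<in> Y'} = X'"
    using beta_remainder_ultrafilter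
    by (auto simp: topspace_beta X' Y' wap_lim_remainder_iff wap_lim_closure_iff)
  have X'_top: "topspace (subtopology beta_topology X') = X'"
    using pre by auto
  have Y'_sub: "Y' \<subseteq> wap_space" by (auto simp: Y' wap_remainder_def)
  have img: "wap_lim ` X' = Y'"
  proof (intro equalityI subsetI)
    fix y assume y: "y \<in> Y'"
    then have "y \<in> wap_lim ` ultrafilters" using Y'_sub by (auto simp: wap_lim_surj)
    then obtain p where p: "p \<in> ultrafilters" "y = wap_lim p" by auto
    then have "p \<in> X'" using y pre by (auto simp: topspace_beta)
    then show "y \<in> wap_lim ` X'" using p(2) by simp
  qed (use pre in auto)
  show "closed_map (subtopology beta_topology X') (subtopology wap_topology Y') wap_lim"
    by (rule closed_map_restriction[OF closed_map_wap_lim pre])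
  show "continuous_map (subtopology beta_topology X') (subtopology wap_topology Y') wap_lim"
    using continuous_map_from_subtopology[OF continuous_map_wap_lim] img X'_top
    by (auto simp: continuous_map_in_subtopology)
  show "wap_lim ` topspace (subtopology beta_topology X') = topspace (subtopology wap_topology Y')"
    using X'_top img Y'_sub by (auto simp: topspace_wap)
  show "inj_on wap_lim (topspace (subtopology beta_topology X'))"
    unfolding X'_top unfolding X' by (rule wap_lim_inj_on)
qed

theorem theorem2p4:
  fixes X Z :: "'a::group_add set set set"
    and Y clsY2 :: "(('a \<Rightarrow> complex) \<Rightarrow> complex) set"
    and \<pi> :: "'a set set \<Rightarrow> (('a \<Rightarrow> complex) \<Rightarrow> complex)"
  assumes "countable (UNIV :: 'a set)" and "infinite (UNIV :: 'a set)"
    and "\<pi> = canonical_map"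
    and "X = beta_remainder" and "Z = Z_R \<union> Z_L"
    and "Y = wap_remainder" and "clsY2 = wap_topology closure_of wap_remainder_sq"
  shows "{p \<in> ultrafilters. \<pi> p \<in> clsY2} = Z
    \<and> {p \<in> ultrafilters. \<pi> p \<in> Y - clsY2} = X - Z
    \<and> openin (subtopology beta_topology X) (X - Z)
    \<and> (subtopology beta_topology X) closure_of (X - Z) = X
    \<and> homeomorphic_map (subtopology beta_topology (X - Z))
                       (subtopology wap_topology (Y - clsY2)) \<pi>"
proof (intro conjI)
  have Z_sub: "Z \<subseteq> ultrafilters"
    using closedin_subset[OF closedin_Z] by (simp add: assms(5) topspace_beta)
  have cls: "\<pi> p \<in> clsY2 \<longleftrightarrow> p \<in> Z" and rem: "\<pi> p \<in> Y \<longleftrightarrow> p \<in> X" if "p \<in> ultrafilters" for p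
    using that by (simp_all add: assms canonical_map_apply wap_lim_closure_iff wap_lim_remainder_iff)
  show "{p \<in> ultrafilters. \<pi> p \<in> clsY2} = Z" using cls Z_sub by auto
  show "{p \<in> ultrafilters. \<pi> p \<in> Y - clsY2} = X - Z"
    using cls rem by (auto simp: assms(4) beta_remainder_ultrafilter)
  have "openin beta_topology (topspace beta_topology - Z)"
    unfolding assms(5) by (rule openin_diff[OF openin_topspace closedin_Z])
  moreover have "X - Z = (topspace beta_topology - Z) \<inter> X"
    by (auto simp: topspace_beta assms(4) beta_remainder_ultrafilter)
  ultimately show "openin (subtopology beta_topology X) (X - Z)"
    unfolding openin_subtopology by auto
  show "(subtopology beta_topology X) closure_of (X - Z) = X"
    unfolding assms(4,5) by (rule remainder_minus_Z_dense[OF assms(1)])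
  \<comment> \<open>Proved for \<open>wap_lim\<close> and then transferred, since the extensional
    map \<open>\<pi>\<close> is known to agree with it only on ultrafilters.\<close>
  have "homeomorphic_map (subtopology beta_topology (X - Z)) (subtopology wap_topology (Y - clsY2)) wap_lim"
    by (rule homeomorphic_map_wap_lim) (simp_all add: assms)
  then show "homeomorphic_map (subtopology beta_topology (X - Z)) (subtopology wap_topology (Y - clsY2)) \<pi>"
  proof (rule homeomorphic_map_eq)
    fix p assume "p \<in> topspace (subtopology beta_topology (X - Z))"
    then have "p \<in> ultrafilters" by (simp add: topspace_beta)
    then show "wap_lim p = \<pi> p" by (simp add: assms(3) canonical_map_apply)
  qed
qed

end
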